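(* Let $G$ be a finite soluble group such that $w(G) \geq 3$ and let $\ell$ be an integer with $3 \leq \ell \leq w(G)$. Then $$\mathfrak{h}_{\ell}(G) \leq \frac{\ell \cdot \mathfrak{h}_{\ell-1}(G) - 2}{\ell - 2}.$$
   Context: For a finite soluble group $G$: $\pi(G)$ is the set of prime divisors of $|G|$ and $w(G)=|\pi(G)|$; $h(G)$ is the Fitting length (nilpotent length) of $G$, with $h(1)=0$. For $\sigma \subseteq \pi(G)$, $G_{\sigma}$ denotes a Hall $\sigma$-subgroup of $G$ (a subgroup whose order is divisible only by primes in $\sigma$ and whose index is divisible by no prime in $\sigma$; it is unique up to conjugacy, so $h(G_\sigma)$ is well defined). For an integer $1 \leq \ell \leq w(G)$, $$\mathfrak{h}_{\ell}(G) = \max\big\{ h(G_{\sigma}) \mid \sigma \subseteq \pi(G),\ |\sigma| = \ell \big\}.$$ *)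

theory Defs
  imports "HOL-Algebra.Algebra"
begin

fun lower_central_series :: "('a, 'b) monoid_scheme \<Rightarrow> nat \<Rightarrow> 'a set" where
  "lower_central_series G 0 = carrier G"
| "lower_central_series G (Suc n) =
     generate G (\<Union>x\<in>carrier G. \<Union>y\<in>lower_central_series G n.
       {x \<otimes>\<^bsub>G\<^esub> y \<otimes>\<^bsub>G\<^esub> inv\<^bsub>G\<^esub> x \<otimes>\<^bsub>G\<^esub> inv\<^bsub>G\<^esub> y})"

definition nilpotent_group :: "('a, 'b) monoid_scheme \<Rightarrow> bool" where
  "nilpotent_group G \<longleftrightarrow> group G \<and> (\<exists>n. lower_central_series G n = {\<one>\<^bsub>G\<^esub>})"

definition fitting_subgroup :: "('a, 'b) monoid_scheme \<Rightarrow> 'a set" where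
  "fitting_subgroup G =
     generate G (\<Union>{N. N \<lhd> G \<and> nilpotent_group (G\<lparr>carrier := N\<rparr>)})"

text \<open>The upper Fitting series: each step is the full preimage in \<open>G\<close> of the
  Fitting subgroup of the quotient by the previous term.\<close>

fun fitting_series :: "('a, 'b) monoid_scheme \<Rightarrow> nat \<Rightarrow> 'a set" where
  "fitting_series G 0 = {\<one>\<^bsub>G\<^esub>}"
| "fitting_series G (Suc n) =
     {x \<in> carrier G. fitting_series G n #>\<^bsub>G\<^esub> x \<in> fitting_subgroup (G Mod fitting_series G n)}"

text \<open>Meaningful only when the upper Fitting series reaches \<open>G\<close>, which holds for
  every finite soluble group.\<close>

definition fitting_length :: "('a, 'b) monoid_scheme \<Rightarrow> nat" where
  "fitting_length G = (LEAST n. fitting_series G n = carrier G)"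

definition prime_divisors :: "('a, 'b) monoid_scheme \<Rightarrow> nat set" where
  "prime_divisors G = prime_factors (order G)"

definition num_prime_divisors :: "('a, 'b) monoid_scheme \<Rightarrow> nat" where
  "num_prime_divisors G = card (prime_divisors G)"

definition hall_subgroup :: "nat set \<Rightarrow> 'a set \<Rightarrow> ('a, 'b) monoid_scheme \<Rightarrow> bool" where
  "hall_subgroup \<sigma> H G \<longleftrightarrow> subgroup H G \<and>
     prime_factors (card H) \<subseteq> \<sigma> \<and>
     (\<forall>p\<in>\<sigma>. \<not> p dvd card (rcosets\<^bsub>G\<^esub> H))"

text \<open>The maximum ranges over all Hall \<open>\<sigma>\<close>-subgroups \<open>H\<close> rather than over one choice
  for each \<open>\<sigma>\<close>. In a finite soluble group the Hall \<open>\<sigma>\<close>-subgroups exist and are conjugate,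
  so this is the same set of values, and it is finite and nonempty for
  \<open>1 \<le> l \<le> num_prime_divisors G\<close>.\<close>

definition hall_fitting_length :: "nat \<Rightarrow> ('a, 'b) monoid_scheme \<Rightarrow> nat" where
  "hall_fitting_length l G =
     Max {fitting_length (G\<lparr>carrier := H\<rparr>) | \<sigma> H.
            \<sigma> \<subseteq> prime_divisors G \<and> card \<sigma> = l \<and> hall_subgroup \<sigma> H G}"

end

theory Submission
  imports Defs
begin

text \<open>
  The Fitting length of a finite soluble group \<open>G\<close> is the largest length of a tower
  \<open>M\<^sub>1 < N\<^sub>1 \<le> M\<^sub>2 < N\<^sub>2 \<le> \<dots>\<close> of normal subgroups in which each \<open>N\<^sub>i / M\<^sub>i\<close> is a
  \<open>q\<^sub>i\<close>-group, \<open>q\<^sub>i \<noteq> q\<^sub>i\<^sub>+\<^sub>1\<close>, and every element of \<open>G\<close> that centralizes \<open>N\<^sub>i / M\<^sub>i\<close> lies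
  in \<open>N\<^sub>i\<close>. A tower bounds the Fitting length from below (\<open>tower_length_le_fitting_length\<close>):
  a normal subgroup that is nilpotent modulo \<open>M\<^sub>1\<close> acts on \<open>N\<^sub>1 / M\<^sub>1\<close> only through its
  \<open>q\<^sub>1\<close>-part, and that part acts trivially on \<open>N\<^sub>2 / M\<^sub>2\<close>, so the subgroup lies in \<open>M\<^sub>2\<close>; thus
  the upper Fitting series needs one step per layer. Conversely (\<open>tower_exists\<close>), a tower of
  length \<open>h(G)\<close> is built upwards by taking \<open>M\<close> to be a \<open>q'\<close>-core and \<open>N\<close> the \<open>q\<close>-core above
  it, where the Hall-Higman lemma supplies the centralizer condition. The lower Fitting series
  steers the choice of \<open>q\<close>, since each layer costs it only one term.

  A tower passes to a Hall \<open>p'\<close>-subgroup \<open>K\<close> (\<open>tower_p_complement\<close>): the layers with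
  \<open>q\<^sub>i \<noteq> p\<close> are covered by \<open>K\<close>, so their intersections with \<open>K\<close> again satisfy the centralizer
  condition, and the layers with \<open>q\<^sub>i = p\<close> are dropped. After that only consecutive equal
  primes have to be merged. Hence \<open>h(K)\<close> is at least the length of the word
  \<open>q\<^sub>1 q\<^sub>2 \<dots> q\<^sub>h\<close> after deletion of \<open>p\<close> and merging of equal neighbours.

  Deleting an interior letter costs at most \<open>2\<close>, the letter itself and one merger of its two
  neighbours; at the two ends it costs \<open>1\<close>. Let \<open>H\<close> be a Hall subgroup for \<open>l\<close> primes with
  \<open>h(H) = h \<ge> 2\<close> maximal, and let \<open>m\<close> be the maximum for \<open>l - 1\<close> primes. Summing over the \<open>l\<close>
  primes gives \<open>l * m \<ge> l * h - 2 * h + 2\<close> (\<open>sum_length_remdups_adj_filter\<close>), which is the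
  claimed inequality; for \<open>h \<le> 1\<close> it follows from \<open>m \<ge> 1\<close>.

  The sections \<open>N / M\<close> are treated inside \<open>G\<close>, by congruences modulo \<open>M\<close>. In this way
  inductions on the order of a section stay within one type.
\<close>

section \<open>Powers and commutators modulo a normal subgroup\<close>

text \<open>
  With \<open>S = powers_of p\<close> this says that the section \<open>W / M\<close> is a \<open>p\<close>-group, and with
  \<open>S = coprime_to p\<close> that it is a \<open>p'\<close>-group. Any multiplicatively closed set of exponents
  containing \<open>1\<close> leads to a class of sections that is closed under extensions.
\<close>
definition torsion_over :: "('a, 'b) monoid_scheme \<Rightarrow> nat set \<Rightarrow> 'a set \<Rightarrow> 'a set \<Rightarrow> bool" where
  "torsion_over G S M W \<longleftrightarrow> (\<forall>x\<in>W. \<exists>k\<in>S. x [^]\<^bsub>G\<^esub> k \<in> M)"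

definition powers_of :: "nat \<Rightarrow> nat set" where
  "powers_of p = range (\<lambda>e. p ^ e)"

definition coprime_to :: "nat \<Rightarrow> nat set" where
  "coprime_to p = {k. coprime k p}"

text \<open>
  The centralizer of the section \<open>K / C\<close>. The commutator is written as in the lower central
  series.
\<close>
definition centralizer_mod :: "('a, 'b) monoid_scheme \<Rightarrow> 'a set \<Rightarrow> 'a set \<Rightarrow> 'a set" where
  "centralizer_mod G K C =
     {c \<in> carrier G. \<forall>x\<in>K. x \<otimes>\<^bsub>G\<^esub> c \<otimes>\<^bsub>G\<^esub> inv\<^bsub>G\<^esub> x \<otimes>\<^bsub>G\<^esub> inv\<^bsub>G\<^esub> c \<in> C}"

lemma (in group) inv_cancel_left:
  assumes "x \<in> carrier G" "y \<in> carrier G"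
  shows "inv x \<otimes> (x \<otimes> y) = y" "x \<otimes> (inv x \<otimes> y) = y"
  using assms by (simp_all add: m_assoc[symmetric])

lemma (in normal) quotient_map_hom: "group_hom G (G Mod H) (\<lambda>x. H #> x)"
  by (simp add: group_hom_def group_hom_axioms_def factorgroup_is_group r_coset_hom_Mod is_group)

lemma (in normal) coset_eq_kernel_iff: "x \<in> carrier G \<Longrightarrow> H #> x = H \<longleftrightarrow> x \<in> H"
  using coset_join1 coset_join2 is_subgroup by blast

lemma (in group) eq_one_of_coprime_pows:
  assumes "x \<in> carrier G" "x [^] (m::nat) = \<one>" "x [^] (k::nat) = \<one>" "coprime m k"
  shows "x = \<one>"
  using assms by (metis coprime_common_divisor_nat pow_eq_id ord_eq_1)

lemma (in group) mem_of_coprime_pows: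
  assumes "subgroup H G" "x \<in> carrier G" "x [^] (m::nat) \<in> H" "x [^] (k::nat) \<in> H" "coprime m k"
  shows "x \<in> H"
proof -
  have "coprime (int m) (int k)" using assms(5) by simp
  then obtain a b where ab: "int m * a + int k * b = 1"
    by (metis bezout_int coprime_imp_gcd_eq_1 mult.commute)
  have "x = x [^] (int m * a + int k * b)" using ab assms(2) by simp
  also have "\<dots> = (x [^] m) [^] a \<otimes> (x [^] k) [^] b"
    using assms(2) by (simp add: int_pow_mult int_pow_pow flip: int_pow_int)
  also have "\<dots> \<in> H"
    using assms subgroup_int_pow_closed subgroup.m_closed by metis
  finally show ?thesis .
qed

text \<open>
  Conjugation by \<open>y\<close> turns \<open>x\<close> into \<open>c \<otimes> x\<close>. If \<open>c\<close> commutes with \<open>x\<close>, then the \<open>m\<close>-th power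
  of this equation reads \<open>\<one> = c\<^sup>m\<close>, and \<open>c\<close> has two coprime exponents.
\<close>
lemma (in group) commutator_trivial_of_coprime:
  assumes x: "x \<in> carrier G" and y: "y \<in> carrier G"
    and c: "c = y \<otimes> x \<otimes> inv y \<otimes> inv x" and comm: "x \<otimes> c = c \<otimes> x"
    and "x [^] (m::nat) = \<one>" "c [^] (k::nat) = \<one>" "coprime m k"
  shows "c = \<one>"
proof -
  have cc: "c \<in> carrier G" using x y c by simp
  have "y \<otimes> x \<otimes> inv y = c \<otimes> x" using x y c by (simp add: m_assoc inv_cancel_left)
  have conj: "(y \<otimes> x \<otimes> inv y) [^] n = y \<otimes> x [^] n \<otimes> inv y" for n :: nat
  proof (induction n)
    case (Suc n)
    have "(y \<otimes> x \<otimes> inv y) [^] Suc n = y \<otimes> x [^] n \<otimes> inv y \<otimes> (y \<otimes> x \<otimes> inv y)" using Suc by simp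
    then show ?case using x y by (simp add: m_assoc inv_cancel_left)
  qed (use y in simp)
  have "(c \<otimes> x) [^] m = c [^] m \<otimes> x [^] m" using cc x comm by (simp add: pow_mult_distrib)
  hence "c [^] m = \<one>"
    using conj[of m] \<open>y \<otimes> x \<otimes> inv y = c \<otimes> x\<close> assms(5) x y cc by simp
  then show ?thesis using eq_one_of_coprime_pows cc assms by blast
qed

lemma (in group_hom) hom_commutator:
  assumes "x \<in> carrier G" "y \<in> carrier G"
  shows "h (x \<otimes> y \<otimes> inv x \<otimes> inv y) = h x \<otimes>\<^bsub>H\<^esub> h y \<otimes>\<^bsub>H\<^esub> inv\<^bsub>H\<^esub> h x \<otimes>\<^bsub>H\<^esub> inv\<^bsub>H\<^esub> h y"
  using assms by simp

lemma (in group) commutator_eq_one_iff: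
  assumes "x \<in> carrier G" "y \<in> carrier G"
  shows "x \<otimes> y \<otimes> inv x \<otimes> inv y = \<one> \<longleftrightarrow> x \<otimes> y = y \<otimes> x"
  using assms by (metis inv_closed inv_solve_right' m_closed l_one one_closed)

text \<open>
  The engine of all coprime action arguments below: modulo \<open>C\<close>, a commutator with an element
  \<open>x\<close> that commutes with \<open>x\<close> and has order prime to that of \<open>x\<close> is trivial.
\<close>
lemma (in group) mod_commutator_trivial_of_coprime:
  assumes C: "C \<lhd> G" and x: "x \<in> carrier G" and y: "y \<in> carrier G"
    and c: "c = y \<otimes> x \<otimes> inv y \<otimes> inv x" and comm: "x \<otimes> c \<otimes> inv x \<otimes> inv c \<in> C"
    and m: "x [^] (m::nat) \<in> C" and k: "c [^] (k::nat) \<in> C" and cop: "coprime m k"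
  shows "c \<in> C"
proof -
  interpret C: normal C G by fact
  interpret q: group_hom G "G Mod C" "\<lambda>x. C #> x" by (rule C.quotient_map_hom)
  have cc: "c \<in> carrier G" using x y c by simp
  have one: "\<one>\<^bsub>G Mod C\<^esub> = C" by simp
  have "C #> c = \<one>\<^bsub>G Mod C\<^esub>"
  proof (rule q.H.commutator_trivial_of_coprime[OF q.hom_closed[OF x] q.hom_closed[OF y] _ _ _ _ cop])
    show "C #> c = (C #> y) \<otimes>\<^bsub>G Mod C\<^esub> (C #> x) \<otimes>\<^bsub>G Mod C\<^esub> inv\<^bsub>G Mod C\<^esub> (C #> y) \<otimes>\<^bsub>G Mod C\<^esub> inv\<^bsub>G Mod C\<^esub> (C #> x)"
      unfolding c using q.hom_commutator[OF y x] .
    have "x \<otimes> c \<otimes> inv x \<otimes> inv c \<in> carrier G" using x cc by simp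
    from iffD2[OF C.coset_eq_kernel_iff[OF this] comm]
    have "C #> (x \<otimes> c \<otimes> inv x \<otimes> inv c) = \<one>\<^bsub>G Mod C\<^esub>" unfolding one .
    then show "(C #> x) \<otimes>\<^bsub>G Mod C\<^esub> (C #> c) = (C #> c) \<otimes>\<^bsub>G Mod C\<^esub> (C #> x)"
      using q.H.commutator_eq_one_iff[OF q.hom_closed[OF x] q.hom_closed[OF cc]] q.hom_commutator[OF x cc] by metis
    show "(C #> x) [^]\<^bsub>G Mod C\<^esub> m = \<one>\<^bsub>G Mod C\<^esub>"
      using C.FactGroup_pow[OF x, of m] C.coset_eq_kernel_iff m x by simp
    show "(C #> c) [^]\<^bsub>G Mod C\<^esub> k = \<one>\<^bsub>G Mod C\<^esub>"
      using C.FactGroup_pow[OF cc, of k] C.coset_eq_kernel_iff k cc by simp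
  qed
  then show ?thesis using C.coset_eq_kernel_iff[OF cc] by simp
qed

lemma (in group) centralizer_mod_normal:
  assumes C: "C \<lhd> G" and K: "K \<lhd> G"
  shows "centralizer_mod G K C \<lhd> G"
proof -
  interpret C: normal C G by fact
  interpret K: normal K G by fact
  have Kc: "x \<in> carrier G" if "x \<in> K" for x using that K.subset by blast
  have Cc: "x \<in> carrier G" if "x \<in> C" for x using that C.subset by blast
  show ?thesis
  proof (rule normal_invI)
    show "subgroup (centralizer_mod G K C) G"
    proof (rule subgroup.intro)
      show "centralizer_mod G K C \<subseteq> carrier G" by (auto simp: centralizer_mod_def)
      show "\<one> \<in> centralizer_mod G K C" using Kc by (auto simp: centralizer_mod_def)
    next
      fix c d assume cd: "c \<in> centralizer_mod G K C" "d \<in> centralizer_mod G K C"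
      then have c: "c \<in> carrier G" "d \<in> carrier G" by (auto simp: centralizer_mod_def)
      have "x \<otimes> (c \<otimes> d) \<otimes> inv x \<otimes> inv (c \<otimes> d) \<in> C" if x: "x \<in> K" for x
      proof -
        have "x \<otimes> (c \<otimes> d) \<otimes> inv x \<otimes> inv (c \<otimes> d) =
          (x \<otimes> c \<otimes> inv x \<otimes> inv c) \<otimes> (c \<otimes> (x \<otimes> d \<otimes> inv x \<otimes> inv d) \<otimes> inv c)"
          using c Kc[OF x] by (simp add: m_assoc inv_mult_group inv_cancel_left)
        then show ?thesis using cd x c by (simp add: centralizer_mod_def C.inv_op_closed2)
      qed
      then show "c \<otimes> d \<in> centralizer_mod G K C" using c by (simp add: centralizer_mod_def)
    next
      fix c assume cd: "c \<in> centralizer_mod G K C"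
      then have c: "c \<in> carrier G" by (auto simp: centralizer_mod_def)
      have "x \<otimes> inv c \<otimes> inv x \<otimes> inv (inv c) \<in> C" if x: "x \<in> K" for x
      proof -
        have "x \<otimes> inv c \<otimes> inv x \<otimes> inv (inv c) = inv c \<otimes> inv (x \<otimes> c \<otimes> inv x \<otimes> inv c) \<otimes> c"
          using c Kc[OF x] by (simp add: m_assoc inv_mult_group inv_cancel_left)
        then show ?thesis using cd x c by (simp add: centralizer_mod_def C.inv_op_closed1)
      qed
      then show "inv c \<in> centralizer_mod G K C" using c by (simp add: centralizer_mod_def)
    qed
  next
    fix g c assume g: "g \<in> carrier G" and cd: "c \<in> centralizer_mod G K C"
    then have c: "c \<in> carrier G" by (auto simp: centralizer_mod_def)
    have "x \<otimes> (g \<otimes> c \<otimes> inv g) \<otimes> inv x \<otimes> inv (g \<otimes> c \<otimes> inv g) \<in> C" if x: "x \<in> K" for x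
    proof -
      let ?y = "inv g \<otimes> x \<otimes> g"
      have y: "?y \<in> K" using g x K.inv_op_closed1 by simp
      have "x \<otimes> (g \<otimes> c \<otimes> inv g) \<otimes> inv x \<otimes> inv (g \<otimes> c \<otimes> inv g) = g \<otimes> (?y \<otimes> c \<otimes> inv ?y \<otimes> inv c) \<otimes> inv g"
        using c g Kc[OF x] by (simp add: m_assoc inv_mult_group inv_cancel_left)
      then show ?thesis using cd y g by (simp add: centralizer_mod_def C.inv_op_closed2)
    qed
    then show "g \<otimes> c \<otimes> inv g \<in> centralizer_mod G K C" using c g by (simp add: centralizer_mod_def)
  qed
qed

text \<open>
  Cauchy's theorem, as the case of exponent one of Sylow's theorem, excludes every prime
  divisor of the order other than \<open>p\<close>.
\<close>
lemma (in group) torsion_group_order: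
  assumes fin: "finite (carrier G)" and p: "Factorial_Ring.prime p"
    and tor: "\<And>x. x \<in> carrier G \<Longrightarrow> \<exists>e::nat. x [^] (p ^ e) = \<one>"
  shows "\<exists>n. order G = p ^ n"
proof -
  have pos: "order G > 0" using fin by (simp add: order_gt_0_iff_finite)
  have "\<not> is_unit p" using p not_prime_unit by blast
  then obtain n m where m: "order G = p ^ n * m" "\<not> p dvd m"
    using multiplicity_decompose'[OF less_imp_neq[OF pos, symmetric]] by metis
  have "m = 1"
  proof (rule ccontr)
    assume "m \<noteq> 1"
    then obtain r where r: "Factorial_Ring.prime r" "r dvd m" using prime_factor_nat by blast
    then have rp: "r \<noteq> p" using m by blast
    have "r dvd order G" using r(2) m(1) dvd_mult by metis
    then obtain k where "order G = r ^ 1 * k" by auto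
    then obtain H where H: "subgroup H G" "card H = r ^ 1"
      using sylow_thm[OF r(1) is_group _ fin] by blast
    have "H \<noteq> {\<one>}" using H(2) r(1) by auto
    then obtain x where x: "x \<in> H" "x \<noteq> \<one>" using subgroup.one_closed[OF H(1)] by blast
    have xc: "x \<in> carrier G" by (rule subgroup.mem_carrier[OF H(1) x(1)])
    obtain e where e: "x [^] (p ^ e) = \<one>" using tor[OF xc] by auto
    have "x [^]\<^bsub>G\<lparr>carrier := H\<rparr>\<^esub> order (G\<lparr>carrier := H\<rparr>) = \<one>"
      using group.pow_order_eq_1[OF subgroup_imp_group[OF H(1)], of x] x by simp
    then have "x [^] r = \<one>" using H(2) by (simp add: order_def nat_pow_consistent[symmetric])
    moreover have "coprime (p ^ e) r" using r(1) p rp by (simp add: primes_coprime)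
    ultimately show False using eq_one_of_coprime_pows[OF xc e] x by blast
  qed
  then show ?thesis using m(1) by auto
qed

lemma (in group) order_eq_card_times_quotient:
  assumes "M \<lhd> G" shows "order G = card M * order (G Mod M)"
  using lagrange[OF normal_imp_subgroup[OF assms]] by (simp add: order_def FactGroup_def mult.commute)

lemma (in group) order_relative_quotient:
  assumes M: "M \<lhd> G" and W: "subgroup W G" and MW: "M \<subseteq> W"
  shows "card W = card M * order (G\<lparr>carrier := W\<rparr> Mod M)"
  using group.order_eq_card_times_quotient[OF subgroup_imp_group[OF W] normal_restrict_supergroup[OF W M MW]]
  by (simp add: order_def)

lemma (in group) card_power_torsion_over:
  assumes fin: "finite (carrier G)" and p: "Factorial_Ring.prime p" and M: "M \<lhd> G" and W: "subgroup W G"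
    and MW: "M \<subseteq> W" and tor: "torsion_over G (powers_of p) M W"
  shows "\<exists>n. card W = card M * p ^ n"
proof -
  interpret W: group "G\<lparr>carrier := W\<rparr>" using subgroup_imp_group[OF W] .
  have MW': "M \<lhd> G\<lparr>carrier := W\<rparr>" using normal_restrict_supergroup[OF W M MW] .
  interpret Q: group "G\<lparr>carrier := W\<rparr> Mod M" using normal.factorgroup_is_group[OF MW'] .
  have "finite W" using fin W subgroup.subset finite_subset by metis
  then have finQ: "finite (carrier (G\<lparr>carrier := W\<rparr> Mod M))" by (simp add: carrier_FactGroup)
  have "\<exists>n. order (G\<lparr>carrier := W\<rparr> Mod M) = p ^ n"
  proof (rule Q.torsion_group_order[OF finQ p])
    fix c assume "c \<in> carrier (G\<lparr>carrier := W\<rparr> Mod M)"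
    then obtain x where x: "x \<in> W" "c = M #> x" by (auto simp: carrier_FactGroup)
    obtain e where e: "x [^] (p ^ e) \<in> M" using tor x unfolding torsion_over_def powers_of_def by blast
    have "c [^]\<^bsub>G\<lparr>carrier := W\<rparr> Mod M\<^esub> (p ^ e) = M #> (x [^] (p ^ e))"
      using normal.FactGroup_pow[OF MW', of x "p ^ e"] x by (simp add: nat_pow_consistent[symmetric])
    also have "\<dots> = M" using coset_join2[OF _ normal_imp_subgroup[OF M] e] e M normal_imp_subgroup subgroup.mem_carrier by fast
    finally show "\<exists>e::nat. c [^]\<^bsub>G\<lparr>carrier := W\<rparr> Mod M\<^esub> (p ^ e) = \<one>\<^bsub>G\<lparr>carrier := W\<rparr> Mod M\<^esub>" by auto
  qed
  then show ?thesis using order_relative_quotient[OF M W MW] by auto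
qed

section \<open>Abelian sections of a soluble group\<close>
lemma (in group) exp_of_derived_normal:
  assumes "H \<lhd> G" shows "(derived G ^^ n) H \<lhd> G"
  using assms derived_is_normal by (induction n) auto

lemma torsion_overD:
  assumes "torsion_over G S M W" "x \<in> W"
  obtains k where "k \<in> S" "x [^]\<^bsub>G\<^esub> k \<in> M"
  using assms unfolding torsion_over_def by blast

lemma (in group) subgroup_nat_pow_closed:
  assumes "subgroup H G" "x \<in> H" shows "x [^] (k::nat) \<in> H"
  using assms subgroup_int_pow_closed[of H x "int k"] by (simp add: int_pow_int)

lemma commutator_in_derived:
  assumes "x \<in> H" "y \<in> H"
  shows "x \<otimes>\<^bsub>G\<^esub> y \<otimes>\<^bsub>G\<^esub> inv\<^bsub>G\<^esub> x \<otimes>\<^bsub>G\<^esub> inv\<^bsub>G\<^esub> y \<in> derived G H"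
  unfolding derived_def by (rule generate.incl) (use assms in blast)

text \<open>
  Commuting elements of \<open>r\<close>-power order have a product of \<open>r\<close>-power order. It is enough that
  the \<open>r\<close>-elements of the section commute with each other, which in the proof of the Hall-Higman
  lemma is all that is known at first.
\<close>
lemma (in group) torsion_part_normal:
  assumes N: "N \<lhd> G" and A: "A \<lhd> G"
    and comm: "\<And>x y e f. x \<in> A \<Longrightarrow> y \<in> A \<Longrightarrow> x [^] (r ^ e :: nat) \<in> N \<Longrightarrow> y [^] (r ^ f :: nat) \<in> N
      \<Longrightarrow> x \<otimes> y \<otimes> inv x \<otimes> inv y \<in> N"
  shows "{x \<in> A. \<exists>e::nat. x [^] (r ^ e) \<in> N} \<lhd> G"
proof -
  interpret N: normal N G by fact
  interpret A: normal A G by fact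
  interpret q: group_hom G "G Mod N" "\<lambda>x. N #> x" by (rule N.quotient_map_hom)
  define Y where "Y = {x \<in> A. \<exists>e::nat. x [^] (r ^ e) \<in> N}"
  have Yc: "x \<otimes> y \<otimes> inv x \<otimes> inv y \<in> N" if "x \<in> Y" "y \<in> Y" for x y
    using that comm unfolding Y_def by blast
  have Ac: "(N #> x) \<otimes>\<^bsub>G Mod N\<^esub> (N #> y) = (N #> y) \<otimes>\<^bsub>G Mod N\<^esub> (N #> x)"
    if xY: "x \<in> Y" and yY: "y \<in> Y" for x y
  proof -
    have xyc: "x \<in> carrier G" "y \<in> carrier G" using xY yY Y_def by auto
    then have "x \<otimes> y \<otimes> inv x \<otimes> inv y \<in> carrier G" by simp
    from iffD2[OF N.coset_eq_kernel_iff[OF this] Yc[OF xY yY]]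
    have "N #> (x \<otimes> y \<otimes> inv x \<otimes> inv y) = \<one>\<^bsub>G Mod N\<^esub>" by simp
    then show ?thesis
      using q.H.commutator_eq_one_iff q.hom_commutator[OF xyc] q.hom_closed xyc by metis
  qed
  have Yiff: "x \<in> Y \<longleftrightarrow> x \<in> A \<and> (\<exists>e::nat. (N #> x) [^]\<^bsub>G Mod N\<^esub> (r ^ e) = \<one>\<^bsub>G Mod N\<^esub>)" for x
  proof -
    have "x [^] (r ^ e) \<in> N \<longleftrightarrow> (N #> x) [^]\<^bsub>G Mod N\<^esub> (r ^ e) = \<one>\<^bsub>G Mod N\<^esub>" if "x \<in> A" for e
      using that N.FactGroup_pow[of x "r ^ e"] N.coset_eq_kernel_iff[of "x [^] (r ^ e)"]
      by auto
    then show ?thesis unfolding Y_def by blast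
  qed
  have "Y \<lhd> G"
  proof (rule normal_invI)
    show "subgroup Y G"
    proof (rule subgroup.intro)
      show "Y \<subseteq> carrier G" unfolding Y_def using A.subset by blast
      show "\<one> \<in> Y" unfolding Y_def using A.one_closed N.one_closed by auto
      show "x \<otimes> y \<in> Y" if x: "x \<in> Y" and y: "y \<in> Y" for x y
      proof -
        obtain e f :: nat where ef: "(N #> x) [^]\<^bsub>G Mod N\<^esub> (r ^ e) = \<one>\<^bsub>G Mod N\<^esub>"
          "(N #> y) [^]\<^bsub>G Mod N\<^esub> (r ^ f) = \<one>\<^bsub>G Mod N\<^esub>" using x y Yiff by blast
        have xyA: "x \<in> A" "y \<in> A" using x y Yiff by auto
        then have xy: "x \<in> carrier G" "y \<in> carrier G" by auto
        have p: "q.H.ord (N #> x) dvd r ^ e" "q.H.ord (N #> y) dvd r ^ f"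
          using ef q.H.pow_eq_id q.hom_closed xy by auto
        have "((N #> x) \<otimes>\<^bsub>G Mod N\<^esub> (N #> y)) [^]\<^bsub>G Mod N\<^esub> (r ^ (e + f)) = \<one>\<^bsub>G Mod N\<^esub>"
          using q.H.pow_mult_distrib[OF Ac[OF x y] q.hom_closed[OF xy(1)] q.hom_closed[OF xy(2)], of "r ^ (e + f)"]
            q.H.pow_eq_id[OF q.hom_closed[OF xy(1)], of "r ^ (e + f)"]
            q.H.pow_eq_id[OF q.hom_closed[OF xy(2)], of "r ^ (e + f)"] p
          by (metis dvd_mult dvd_mult2 power_add q.H.l_one q.H.one_closed)
        then show ?thesis using Yiff[of "x \<otimes> y"] xyA A.m_closed q.hom_mult[OF xy] by metis
      qed
      show "inv x \<in> Y" if x: "x \<in> Y" for x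
      proof -
        have "x \<in> A" using x Y_def by auto
        then have "x \<in> carrier G" by auto
        then show ?thesis using x nat_pow_inv unfolding Y_def by auto
      qed
    qed
    fix g x assume g: "g \<in> carrier G" and x: "x \<in> Y"
    have xA: "x \<in> A" using x Y_def by auto
    then have xc: "x \<in> carrier G" by auto
    have conj: "(g \<otimes> x \<otimes> inv g) [^] n = g \<otimes> x [^] n \<otimes> inv g" for n :: nat
    proof (induction n)
      case (Suc n)
      then have "(g \<otimes> x \<otimes> inv g) [^] Suc n = g \<otimes> x [^] n \<otimes> inv g \<otimes> (g \<otimes> x \<otimes> inv g)" by simp
      then show ?case using xc g by (simp add: m_assoc inv_cancel_left)
    qed (use g in simp)
    show "g \<otimes> x \<otimes> inv g \<in> Y" using x xA g conj N.inv_op_closed2 A.inv_op_closed2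
      unfolding Y_def by auto
  qed
  then show ?thesis unfolding Y_def .
qed

text \<open>
  A substitute for the existence of minimal normal subgroups above \<open>N\<close>. The last term of
  \<open>W \<inter> G\<^sup>(\<^sup>n\<^sup>)\<close> not contained in \<open>N\<close> is abelian modulo \<open>N\<close>; for a prime \<open>r\<close> dividing the order
  of one of its elements modulo \<open>N\<close>, the \<open>r\<close>-elements of this abelian section form \<open>Y\<close>.
\<close>
lemma (in group) abelian_torsion_section_exists:
  assumes fin: "finite (carrier G)" and sol: "solvable G"
    and N: "N \<lhd> G" and W: "W \<lhd> G" and NW: "N \<subseteq> W" "N \<noteq> W"
  obtains r Y where "Factorial_Ring.prime r" "Y \<lhd> G" "N \<subseteq> Y" "N \<noteq> Y" "Y \<subseteq> W"
    "torsion_over G (powers_of r) N Y"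
    "\<And>x y. x \<in> Y \<Longrightarrow> y \<in> Y \<Longrightarrow> x \<otimes> y \<otimes> inv x \<otimes> inv y \<in> N"
proof -
  interpret N: normal N G by fact
  interpret W: normal W G by fact
  interpret q: group_hom G "G Mod N" "\<lambda>x. N #> x" by (rule N.quotient_map_hom)
  define D where "D n = W \<inter> (derived G ^^ n) (carrier G)" for n
  have Dn: "D n \<lhd> G" for n
    unfolding D_def using normal_subgroup_intersect[OF W exp_of_derived_normal[OF normal_self]] .
  obtain n0 where "(derived G ^^ n0) (carrier G) = {\<one>}"
    using sol solvable_iff_trivial_derived_seq by blast
  then have ex: "D n0 \<subseteq> N" unfolding D_def using N.one_closed by auto
  define n where "n = (LEAST n. D n \<subseteq> N)"
  have n: "D n \<subseteq> N" unfolding n_def using ex by (rule LeastI)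
  have "\<not> D 0 \<subseteq> N" using NW W.subset unfolding D_def by auto
  then obtain k where k: "n = Suc k" using n by (cases n) auto
  have nk: "\<not> D k \<subseteq> N" using not_less_Least[of k "\<lambda>n. D n \<subseteq> N"] k unfolding n_def by simp
  interpret D: normal "D k" G by (rule Dn)
  have comm: "x \<otimes> y \<otimes> inv x \<otimes> inv y \<in> N" if "x \<in> D k" "y \<in> D k" for x y
  proof -
    have "x \<otimes> y \<otimes> inv x \<otimes> inv y \<in> W" using that unfolding D_def by auto
    moreover have "x \<otimes> y \<otimes> inv x \<otimes> inv y \<in> derived G ((derived G ^^ k) (carrier G))"
      by (rule commutator_in_derived) (use that in \<open>auto simp: D_def\<close>)
    ultimately have "x \<otimes> y \<otimes> inv x \<otimes> inv y \<in> D (Suc k)" unfolding D_def by simp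
    then show ?thesis using n k by blast
  qed
  define A where "A = {x \<in> carrier G. \<exists>a\<in>D k. N #> x = N #> a}"
  have Ac: "(N #> x) \<otimes>\<^bsub>G Mod N\<^esub> (N #> y) = (N #> y) \<otimes>\<^bsub>G Mod N\<^esub> (N #> x)"
    if xA: "x \<in> A" and yA: "y \<in> A" for x y
  proof -
    obtain a b where ab: "a \<in> D k" "b \<in> D k" "N #> x = N #> a" "N #> y = N #> b"
      using xA yA unfolding A_def by blast
    have abc: "a \<in> carrier G" "b \<in> carrier G" using ab(1,2) D.subset by auto
    then have "a \<otimes> b \<otimes> inv a \<otimes> inv b \<in> carrier G" by simp
    from iffD2[OF N.coset_eq_kernel_iff[OF this] comm[OF ab(1,2)]]
    have "N #> (a \<otimes> b \<otimes> inv a \<otimes> inv b) = \<one>\<^bsub>G Mod N\<^esub>" by simp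
    then show ?thesis unfolding ab(3,4)
      using q.H.commutator_eq_one_iff q.hom_commutator[OF abc] q.hom_closed abc by metis
  qed
  obtain y where y: "y \<in> D k" "y \<notin> N" using nk by blast
  have yc: "y \<in> carrier G" using y D.subset by auto
  let ?o = "q.H.ord (N #> y)"
  have fq: "finite (carrier (G Mod N))" using fin by (simp add: carrier_FactGroup)
  have "?o \<noteq> 1" using q.H.ord_eq_1[OF q.hom_closed[OF yc]] N.coset_eq_kernel_iff[OF yc] y(2) by simp
  then obtain r where r: "Factorial_Ring.prime r" "r dvd ?o" using prime_factor_nat by blast
  have o0: "?o \<noteq> 0" using q.H.ord_ge_1[OF fq q.hom_closed[OF yc]] by linarith
  define Y where "Y = {x \<in> A. \<exists>e::nat. x [^] (r ^ e) \<in> N}"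
  have Asub: "A \<subseteq> W"
  proof
    fix x assume "x \<in> A"
    then obtain a where a: "a \<in> D k" "x \<in> carrier G" "N #> x = N #> a" unfolding A_def by blast
    then have "x \<in> N #> a" using rcos_self[OF a(2) N.is_subgroup] by simp
    then obtain v where "v \<in> N" "x = v \<otimes> a" unfolding r_coset_def by blast
    then show "x \<in> W" using a NW unfolding D_def by auto
  qed
  have A: "A \<lhd> G"
  proof (rule normal_invI)
    show "subgroup A G"
    proof (rule subgroup.intro)
      show "A \<subseteq> carrier G" unfolding A_def by blast
      show "\<one> \<in> A" unfolding A_def using D.one_closed by blast
      show "x \<otimes> y \<in> A" if xA: "x \<in> A" and yA: "y \<in> A" for x y
      proof -
        obtain a b where ab: "a \<in> D k" "b \<in> D k" "N #> x = N #> a" "N #> y = N #> b"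
          "x \<in> carrier G" "y \<in> carrier G"
          using xA[unfolded A_def] yA[unfolded A_def] by blast
        have abc: "a \<in> carrier G" "b \<in> carrier G" using ab(1,2) D.subset by auto
        have "N #> (x \<otimes> y) = N #> (a \<otimes> b)"
          unfolding N.rcos_sum[OF ab(5,6), symmetric] N.rcos_sum[OF abc, symmetric] ab(3,4) by (rule refl)
        then show ?thesis unfolding A_def using ab D.m_closed by blast
      qed
      show "inv x \<in> A" if xA: "x \<in> A" for x
      proof -
        obtain a where ab: "a \<in> D k" "N #> x = N #> a" "x \<in> carrier G"
          using xA[unfolded A_def] by blast
        have ac: "a \<in> carrier G" using ab(1) D.subset by auto
        have "N #> (inv x) = N #> (inv a)"
          unfolding q.hom_inv[OF ab(3)] q.hom_inv[OF ac] ab(2) by (rule refl)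
        then show ?thesis unfolding A_def using ab D.m_inv_closed by blast
      qed
    qed
    fix g x assume g: "g \<in> carrier G" and "x \<in> A"
    then obtain a where ab: "a \<in> D k" "N #> x = N #> a" "x \<in> carrier G"
      unfolding A_def by blast
    have ac: "a \<in> carrier G" using ab D.subset by blast
    have "N #> (g \<otimes> x \<otimes> inv g) = N #> (g \<otimes> a \<otimes> inv g)"
      using g ab ac q.hom_mult by simp
    then show "g \<otimes> x \<otimes> inv g \<in> A" unfolding A_def using ab D.inv_op_closed2 g by blast
  qed
  interpret A: normal A G by fact
  have NA: "N \<subseteq> A"
  proof
    fix x assume x: "x \<in> N"
    then have "N #> x = N #> \<one>" using N.coset_eq_kernel_iff[of x] N.subset by auto
    then show "x \<in> A" unfolding A_def using x N.subset D.one_closed by blast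
  qed
  have Acomm: "x \<otimes> y \<otimes> inv x \<otimes> inv y \<in> N" if xyA: "x \<in> A" "y \<in> A" for x y
  proof -
    have xyc: "x \<in> carrier G" "y \<in> carrier G" using xyA by auto
    have "N #> (x \<otimes> y \<otimes> inv x \<otimes> inv y) = \<one>\<^bsub>G Mod N\<^esub>"
      using q.H.commutator_eq_one_iff q.hom_commutator[OF xyc] q.hom_closed xyc Ac[OF xyA] by metis
    then show ?thesis using N.coset_eq_kernel_iff[of "x \<otimes> y \<otimes> inv x \<otimes> inv y"] xyc by simp
  qed
  have Y: "Y \<lhd> G"
    unfolding Y_def by (rule torsion_part_normal[OF N A]) (use Acomm in blast)
  have "N \<noteq> Y"
  proof -
    let ?z = "y [^] (?o div r)"
    have zk: "?z \<in> D k" using y subgroup_nat_pow_closed D.is_subgroup by blast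
    then have zc: "?z \<in> carrier G" using D.subset by auto
    have "?z \<in> A" unfolding A_def using zk zc by blast
    moreover have "?z [^] (r ^ 1) \<in> N"
    proof -
      have "?z [^] (r ^ 1) = y [^] ?o" using r yc by (simp add: nat_pow_pow)
      moreover have "N #> (y [^] ?o) = N"
        using N.FactGroup_pow[OF yc, of ?o] q.H.pow_ord_eq_1[OF q.hom_closed[OF yc]] by simp
      ultimately show ?thesis using N.coset_eq_kernel_iff[of "y [^] ?o"] yc by simp
    qed
    ultimately have "?z \<in> Y" unfolding Y_def by blast
    moreover have "?z \<notin> N"
    proof
      assume "?z \<in> N"
      then have "N #> ?z = N" using N.coset_eq_kernel_iff zc by blast
      then have "(N #> y) [^]\<^bsub>G Mod N\<^esub> (?o div r) = \<one>\<^bsub>G Mod N\<^esub>"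
        using N.FactGroup_pow[OF yc, of "?o div r"] by simp
      then have d: "?o dvd ?o div r" using q.H.pow_eq_id[OF q.hom_closed[OF yc]] by blast
      have "?o div r < ?o" "?o div r > 0"
        using r o0 prime_gt_1_nat[OF r(1)] by (auto simp: dvd_div_eq_0_iff)
      then show False using d nat_dvd_not_less by blast
    qed
    ultimately show ?thesis by blast
  qed
  moreover have "N \<subseteq> Y"
  proof
    fix x assume x: "x \<in> N"
    then have "x [^] (r ^ 0) \<in> N" using N.subset by auto
    then show "x \<in> Y" unfolding Y_def using x NA by blast
  qed
  moreover have "Y \<subseteq> W" using Asub Y_def by blast
  moreover have "torsion_over G (powers_of r) N Y"
    unfolding torsion_over_def powers_of_def Y_def by blast
  moreover have "x \<otimes> y \<otimes> inv x \<otimes> inv y \<in> N" if "x \<in> Y" "y \<in> Y" for x y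
    using that Acomm Y_def by auto
  ultimately show thesis using that r(1) Y by blast
qed

section \<open>Torsion cores and the Hall-Higman lemma\<close>
lemma (in group) nat_pow_mem_mod:
  assumes N: "N \<lhd> G" and xy: "x \<in> carrier G" "y \<in> carrier G" "N #> x = N #> y"
    and k: "y [^] (k::nat) \<in> N"
  shows "x [^] k \<in> N"
proof -
  interpret N: normal N G by fact
  have "N #> (x [^] k) = N #> (y [^] k)"
    using N.FactGroup_pow[OF xy(1), of k] N.FactGroup_pow[OF xy(2), of k] xy(3) by simp
  also have "\<dots> = N" using N.coset_eq_kernel_iff[of "y [^] k"] k xy by simp
  finally show ?thesis using N.coset_eq_kernel_iff[of "x [^] k"] xy by simp
qed

text \<open>
  This is \<open>O\<^sub>p(G / M)\<close> or \<open>O\<^sub>p\<^sub>'(G / M)\<close>, depending on \<open>S\<close>. A maximal normal subgroup that is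
  torsion over \<open>M\<close> absorbs every other one, because the product of the two is again torsion.
\<close>
lemma (in group) torsion_core_exists:
  assumes fin: "finite (carrier G)" and M: "M \<lhd> G"
    and S1: "1 \<in> S" and Sm: "\<And>k l. k \<in> S \<Longrightarrow> l \<in> S \<Longrightarrow> k * l \<in> S"
  obtains C where "C \<lhd> G" "M \<subseteq> C" "torsion_over G S M C"
    "\<And>W. W \<lhd> G \<Longrightarrow> torsion_over G S M W \<Longrightarrow> W \<subseteq> C"
proof -
  define \<C> where "\<C> = {C. C \<lhd> G \<and> M \<subseteq> C \<and> torsion_over G S M C}"
  have "\<C> \<subseteq> Pow (carrier G)"
    unfolding \<C>_def using normal_imp_subgroup subgroup.subset by blast
  then have f\<C>: "finite \<C>" using fin finite_subset by blast
  have "torsion_over G S M M"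
    unfolding torsion_over_def using S1 subgroup_nat_pow_closed[OF normal_imp_subgroup[OF M]] by blast
  then have "M \<in> \<C>" unfolding \<C>_def using M by simp
  then obtain C where C: "C \<in> \<C>" "\<And>B. B \<in> \<C> \<Longrightarrow> C \<subseteq> B \<Longrightarrow> C = B"
    using finite_has_maximal[OF f\<C>] by auto
  have Cn: "C \<lhd> G" and MC: "M \<subseteq> C" and tC: "torsion_over G S M C" using C unfolding \<C>_def by auto
  interpret C: normal C G by fact
  have "W \<subseteq> C" if W: "W \<lhd> G" and tW: "torsion_over G S M W" for W
  proof -
    interpret W: normal W G by fact
    have 1: "C \<subseteq> C <#> W"
    proof
      fix x assume "x \<in> C"
      then have "x \<otimes> \<one> \<in> C <#> W" unfolding set_mult_def using W.one_closed by blast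
      then show "x \<in> C <#> W" using \<open>x \<in> C\<close> C.subset by auto
    qed
    have 2: "W \<subseteq> C <#> W"
    proof
      fix x assume "x \<in> W"
      then have "\<one> \<otimes> x \<in> C <#> W" unfolding set_mult_def using C.one_closed by blast
      then show "x \<in> C <#> W" using \<open>x \<in> W\<close> W.subset by auto
    qed
    have "torsion_over G S M (C <#> W)"
      unfolding torsion_over_def
    proof
      fix x assume "x \<in> C <#> W"
      then obtain c w where cw: "c \<in> C" "w \<in> W" "x = c \<otimes> w" unfolding set_mult_def by blast
      have wc: "w \<in> carrier G" "c \<in> carrier G" using cw W.subset C.subset by auto
      obtain k where k: "k \<in> S" "w [^] k \<in> M" using tW cw torsion_overD by metis
      have "C #> x = C #> w"
        unfolding cw(3) using coset_mult_assoc[OF C.subset wc(2,1)] coset_join2[OF wc(2) C.is_subgroup cw(1)] by simp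
      then have "x [^] k \<in> C" using nat_pow_mem_mod[OF Cn _ wc(1), of x k] k MC wc cw by auto
      then obtain l where "l \<in> S" "(x [^] k) [^] l \<in> M" using tC torsion_overD by metis
      then have "k * l \<in> S" "x [^] (k * l) \<in> M" using Sm k cw wc by (auto simp: nat_pow_pow)
      then show "\<exists>k\<in>S. x [^] k \<in> M" by blast
    qed
    then have "C <#> W \<in> \<C>"
      unfolding \<C>_def using 1 MC normal_subgroup_set_mult_closed[OF Cn W] by auto
    then show ?thesis using C(2) 1 2 by blast
  qed
  then show thesis using that Cn MC tC by blast
qed

lemma powers_of_closed:
  "1 \<in> powers_of p" "k \<in> powers_of p \<Longrightarrow> l \<in> powers_of p \<Longrightarrow> k * l \<in> powers_of p"
proof -
  show "1 \<in> powers_of p" unfolding powers_of_def using power_0[of p] by (metis rangeI)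
  assume "k \<in> powers_of p" "l \<in> powers_of p"
  then show "k * l \<in> powers_of p" unfolding powers_of_def by (auto simp: power_add[symmetric])
qed

lemma coprime_to_closed:
  "1 \<in> coprime_to p" "k \<in> coprime_to p \<Longrightarrow> l \<in> coprime_to p \<Longrightarrow> k * l \<in> coprime_to p"
  unfolding coprime_to_def by auto

lemma (in group) torsion_over_trans:
  assumes "W \<subseteq> carrier G" "torsion_over G S Z W" "torsion_over G S M Z"
    and Sm: "\<And>k l. k \<in> S \<Longrightarrow> l \<in> S \<Longrightarrow> k * l \<in> S"
  shows "torsion_over G S M W"
  unfolding torsion_over_def
proof
  fix x assume x: "x \<in> W"
  obtain k where k: "k \<in> S" "x [^] k \<in> Z" using torsion_overD[OF assms(2) x] .
  obtain l where l: "l \<in> S" "(x [^] k) [^] l \<in> M" using torsion_overD[OF assms(3) k(2)] .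
  have "x [^] (k * l) \<in> M" using l x assms(1) by (auto simp: nat_pow_pow)
  then show "\<exists>k\<in>S. x [^] k \<in> M" using Sm k l by blast
qed

lemma torsion_over_mono:
  assumes "torsion_over G S M W" "W' \<subseteq> W" "M \<subseteq> M'"
  shows "torsion_over G S M' W'"
  using assms unfolding torsion_over_def by blast

lemma (in normal) subset_centralizer_mod:
  assumes "K \<subseteq> carrier G"
  shows "H \<subseteq> centralizer_mod G K H"
  unfolding centralizer_mod_def using assms inv_op_closed2 by auto

lemma (in group) commutator_swap_mem:
  assumes "subgroup H G" "x \<in> carrier G" "y \<in> carrier G" "x \<otimes> y \<otimes> inv x \<otimes> inv y \<in> H"
  shows "y \<otimes> x \<otimes> inv y \<otimes> inv x \<in> H"
proof -
  have "inv (x \<otimes> y \<otimes> inv x \<otimes> inv y) = y \<otimes> x \<otimes> inv y \<otimes> inv x"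
    using assms by (simp add: m_assoc inv_mult_group)
  then show ?thesis using subgroup.m_inv_closed[OF assms(1,4)] by simp
qed

text \<open>
  The Hall-Higman lemma: if \<open>O\<^sub>q\<^sub>'(G / M)\<close> is trivial, then \<open>N / M = O\<^sub>q(G / M)\<close> contains its
  centralizer. Otherwise there is an abelian \<open>r\<close>-section \<open>Y / Z\<close> just above
  \<open>Z = C \<inter> N\<close> inside the centralizer \<open>C\<close>. For \<open>r = q\<close> it would enlarge \<open>O\<^sub>q(G / M)\<close>; for
  \<open>r \<noteq> q\<close> the \<open>q\<close>-group \<open>Z / M\<close> is central in \<open>Y / M\<close>, so that the \<open>r\<close>-elements of \<open>Y / M\<close>
  form a nontrivial normal \<open>q'\<close>-subgroup.
\<close>
lemma (in group) hall_higman: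
  assumes fin: "finite (carrier G)" and sol: "solvable G" and q: "Factorial_Ring.prime q"
    and M: "M \<lhd> G" and N: "N \<lhd> G" and MN: "M \<subseteq> N" and tN: "torsion_over G (powers_of q) M N"
    and maxN: "\<And>W. W \<lhd> G \<Longrightarrow> torsion_over G (powers_of q) M W \<Longrightarrow> W \<subseteq> N"
    and triv: "\<And>W. W \<lhd> G \<Longrightarrow> torsion_over G (coprime_to q) M W \<Longrightarrow> W \<subseteq> M"
  shows "centralizer_mod G N M \<subseteq> N"
proof (rule ccontr)
  assume nsub: "\<not> centralizer_mod G N M \<subseteq> N"
  define C where "C = centralizer_mod G N M"
  define Z where "Z = C \<inter> N"
  have Cn: "C \<lhd> G" unfolding C_def by (rule centralizer_mod_normal[OF M N])
  have Zn: "Z \<lhd> G" unfolding Z_def by (rule normal_subgroup_intersect[OF Cn N])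
  interpret M: normal M G by fact
  interpret N: normal N G by fact
  interpret C: normal C G by fact
  interpret Z: normal Z G by fact
  have MZ: "M \<subseteq> Z" unfolding Z_def C_def using M.subset_centralizer_mod[OF N.subset] MN by blast
  have ZC: "Z \<subseteq> C" "Z \<noteq> C" using nsub unfolding Z_def C_def by auto
  obtain r Y where r: "Factorial_Ring.prime r" and Yn: "Y \<lhd> G" and ZY: "Z \<subseteq> Y" "Z \<noteq> Y" and YC: "Y \<subseteq> C"
    and tY: "torsion_over G (powers_of r) Z Y"
    and cY: "\<And>x y. x \<in> Y \<Longrightarrow> y \<in> Y \<Longrightarrow> x \<otimes> y \<otimes> inv x \<otimes> inv y \<in> Z"
    using abelian_torsion_section_exists[OF fin sol Zn Cn ZC] by metis
  interpret Y: normal Y G by fact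
  have tZ: "torsion_over G (powers_of q) M Z" using torsion_over_mono[OF tN] Z_def by auto
  show False
  proof (cases "r = q")
    case True
    have "torsion_over G (powers_of q) M Y"
      using torsion_over_trans[OF Y.subset tY[unfolded True] tZ powers_of_closed(2)] by blast
    then have "Y \<subseteq> N" using maxN Yn by blast
    then show False using ZY YC unfolding Z_def by blast
  next
    case False
    have cop: "coprime (r ^ e) (q ^ f)" for e f using r q False by (simp add: primes_coprime)
    define W where "W = {x \<in> Y. \<exists>e::nat. x [^] (r ^ e) \<in> M}"
    have "W \<lhd> G" unfolding W_def
    proof (rule torsion_part_normal[OF M Yn])
      fix x y and e f :: nat
      assume xy: "x \<in> Y" "y \<in> Y" and xe: "x [^] (r ^ e) \<in> M" and ye: "y [^] (r ^ f) \<in> M"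
      have xyc: "x \<in> carrier G" "y \<in> carrier G" using xy by auto
      let ?c = "x \<otimes> y \<otimes> inv x \<otimes> inv y"
      have cZ: "?c \<in> Z" using cY xy by blast
      obtain k where k: "k \<in> powers_of q" "?c [^] k \<in> M" using torsion_overD[OF tZ cZ] .
      then obtain g where g: "k = q ^ g" unfolding powers_of_def by blast
      have cc: "?c \<in> carrier G" using xyc by simp
      have "y \<in> C" using xy YC by blast
      then have "?c \<otimes> y \<otimes> inv ?c \<otimes> inv y \<in> M"
        unfolding C_def centralizer_mod_def using cZ unfolding Z_def by blast
      then have "y \<otimes> ?c \<otimes> inv y \<otimes> inv ?c \<in> M"
        using commutator_swap_mem[OF M.is_subgroup cc xyc(2)] by blast
      then show "?c \<in> M"
        using mod_commutator_trivial_of_coprime[OF M xyc(2,1) refl _ ye k(2)] cop g by blast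
    qed
    moreover have "torsion_over G (coprime_to q) M W"
      unfolding torsion_over_def W_def coprime_to_def using cop[of _ 1, unfolded power_one_right] by blast
    ultimately have WM: "W \<subseteq> M" using triv by blast
    (* The q-part of an element of Y outside Z can be removed by a power, and the result is
       an r-element outside Z. *)
    obtain y where y: "y \<in> Y" "y \<notin> Z" using ZY by blast
    then have yc: "y \<in> carrier G" by auto
    obtain e where e: "y [^] (r ^ e) \<in> Z" using torsion_overD[OF tY y(1)] unfolding powers_of_def by blast
    obtain f where f: "(y [^] (r ^ e)) [^] (q ^ f) \<in> M" using torsion_overD[OF tZ e] unfolding powers_of_def by blast
    then have "(y [^] (q ^ f)) [^] (r ^ e) \<in> M" using yc by (simp add: nat_pow_pow mult.commute)
    then have "y [^] (q ^ f) \<in> W" unfolding W_def using y subgroup_nat_pow_closed[OF Y.is_subgroup] by blast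
    then have "y [^] (q ^ f) \<in> Z" using WM MZ by blast
    then show False using mem_of_coprime_pows[OF Z.is_subgroup yc e _ cop] y by blast
  qed
qed

section \<open>Fixed points of p-groups and nilpotency of p-sections\<close>

text \<open>
  Orbits have \<open>s\<close>-power length, so their lengths cannot all be divisible by \<open>s\<close>. The group
  itself need not be an \<open>s\<close>-group: only the quotient by a subgroup \<open>M\<close> that acts trivially
  has \<open>s\<close>-power order, which allows the statement to be used for sections.
\<close>
lemma (in group) fixed_point_exists:
  assumes fin: "finite (carrier G)" "finite E"
    and closed: "\<And>x e. x \<in> carrier G \<Longrightarrow> e \<in> E \<Longrightarrow> act x e \<in> E"
    and one: "\<And>e. e \<in> E \<Longrightarrow> act \<one> e = e"
    and mult: "\<And>x y e. x \<in> carrier G \<Longrightarrow> y \<in> carrier G \<Longrightarrow> e \<in> E \<Longrightarrow> act (x \<otimes> y) e = act x (act y e)"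
    and M: "subgroup M G" and ker: "\<And>m e. m \<in> M \<Longrightarrow> e \<in> E \<Longrightarrow> act m e = e"
    and s: "Factorial_Ring.prime (s::nat)" and card: "order G = card M * s ^ n"
    and nd: "\<not> s dvd card E"
  shows "\<exists>e\<in>E. \<forall>x\<in>carrier G. act x e = e"
proof -
  define \<phi> where "\<phi> x = restrict (act x) E" for x
  have bij: "\<phi> x \<in> Bij E" if x: "x \<in> carrier G" for x
  proof -
    have "bij_betw (act x) E E"
      by (rule bij_betwI[where g = "act (inv x)"]) (use x closed one mult[symmetric] in auto)
    then have "bij_betw (\<phi> x) E E" unfolding \<phi>_def by (simp add: bij_betw_restrict_eq)
    then show ?thesis unfolding Bij_def \<phi>_def by simp
  qed
  have "group_hom G (BijGroup E) \<phi>"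
    unfolding group_hom_def group_hom_axioms_def
  proof (intro conjI group_BijGroup is_group homI)
    show "\<phi> x \<in> carrier (BijGroup E)" if "x \<in> carrier G" for x
      using bij[OF that] by (simp add: BijGroup_def)
    show "\<phi> (x \<otimes> y) = \<phi> x \<otimes>\<^bsub>BijGroup E\<^esub> \<phi> y" if xy: "x \<in> carrier G" "y \<in> carrier G" for x y
    proof -
      have "\<phi> x \<otimes>\<^bsub>BijGroup E\<^esub> \<phi> y = compose E (\<phi> x) (\<phi> y)"
        using bij xy by (simp add: BijGroup_def)
      also have "\<dots> = \<phi> (x \<otimes> y)"
        unfolding \<phi>_def compose_def using mult[OF xy] closed[OF xy(2)] by (intro ext) auto
      finally show ?thesis by simp
    qed
  qed
  then interpret act: group_action G E \<phi> by (rule group_action.intro)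
  show ?thesis
  proof (rule ccontr)
    assume nt: "\<not> ?thesis"
    have dv: "s dvd card O'" if O': "O' \<in> orbits G E \<phi>" for O'
    proof -
      obtain e where e: "e \<in> E" "O' = orbit G \<phi> e" using O' unfolding orbits_def by blast
      let ?S = "stabilizer G \<phi> e"
      have S: "subgroup ?S G" by (rule act.stabilizer_subgroup[OF e(1)])
      have MS: "M \<subseteq> ?S"
        unfolding stabilizer_def \<phi>_def using ker e(1) subgroup.subset[OF M] by auto
      have "subgroup M (G\<lparr>carrier := ?S\<rparr>)" using subgroup_incl[OF M S MS] .
      then have "card M dvd card ?S"
        using group.lagrange[OF subgroup_imp_group[OF S]] unfolding order_def by (metis dvd_triv_right partial_object.select_convs(1) partial_object.update_convs(1) partial_object.surjective)
      then obtain t where t: "card ?S = card M * t" by blast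
      have "card O' * (card M * t) = card M * s ^ n"
        using act.orbit_stabilizer_theorem[OF e(1)] card t e(2) by simp
      moreover have "card M > 0" using subgroup.one_closed[OF M] subgroup.subset[OF M] fin(1)
        by (metis card_gt_0_iff empty_iff finite_subset)
      ultimately have "card O' * t = s ^ n" by simp
      then have "card O' dvd s ^ n" by (metis dvd_triv_left)
      then obtain i where i: "card O' = s ^ i" using divides_primepow_nat[OF s] by blast
      show ?thesis
      proof (cases "i = 0")
        case True
        then have "card O' = 1" using i by simp
        then obtain d where d: "O' = {d}" using card_1_singletonE by blast
        have "e \<in> O'" unfolding e(2) by (rule act.orbit_refl[OF e(1)])
        then have "O' = {e}" using d by simp
        then have "act x e = e" if "x \<in> carrier G" for x
          using that e unfolding orbit_def \<phi>_def by auto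
        then show ?thesis using nt e(1) by blast
      next
        case False
        then show ?thesis unfolding i by simp
      qed
    qed
    interpret part: partition E "orbits G E \<phi>" by (rule act.orbit_partition)
    have un: "\<Union>(orbits G E \<phi>) = E" by (rule part.partition_coverture)
    have "s dvd card (\<Union>(orbits G E \<phi>))"
    proof (rule dvd_partition)
      show "finite (\<Union>(orbits G E \<phi>))" using un fin by simp
      show "\<forall>c\<in>orbits G E \<phi>. s dvd card c" using dv by blast
      show "\<forall>c1\<in>orbits G E \<phi>. \<forall>c2\<in>orbits G E \<phi>. c1 \<noteq> c2 \<longrightarrow> c1 \<inter> c2 = {}"
        using part.disjoint_union by blast
    qed
    then show False using un nd by simp
  qed
qed

text \<open>
  The section \<open>W / M\<close> acts on its nontrivial elements by conjugation; their number is
  \<open>q\<^sup>n - 1\<close>, so there is a fixed point, which is a nontrivial central element.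
\<close>
lemma (in group) central_element_mod_exists:
  assumes fin: "finite (carrier G)" and q: "Factorial_Ring.prime q"
    and M: "M \<lhd> G" and W: "W \<lhd> G" and MW: "M \<subseteq> W" "M \<noteq> W" and tor: "torsion_over G (powers_of q) M W"
  obtains z where "z \<in> W" "z \<notin> M" "\<And>x. x \<in> W \<Longrightarrow> x \<otimes> z \<otimes> inv x \<otimes> inv z \<in> M"
proof -
  interpret M: normal M G by fact
  interpret W: normal W G by fact
  have grpW: "group (G\<lparr>carrier := W\<rparr>)" using subgroup_imp_group[OF W.is_subgroup] .
  have MnW: "M \<lhd> G\<lparr>carrier := W\<rparr>" using normal_restrict_supergroup[OF W.is_subgroup M MW(1)] .
  have finW: "finite W" using fin W.subset finite_subset by blast
  obtain n where n: "card W = card M * q ^ n"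
    using card_power_torsion_over[OF fin q M W.is_subgroup MW(1) tor] by blast
  have cM: "card M > 0" using M.one_closed finW MW by (metis card_gt_0_iff empty_iff finite_subset)
  have n0: "n \<noteq> 0"
  proof
    assume "n = 0"
    then have "card M = card W" using n by simp
    then show False using MW finW card_subset_eq by blast
  qed
  define Q where "Q = (\<lambda>x. M #> x) ` W"
  have Q: "Q = rcosets\<^bsub>G\<lparr>carrier := W\<rparr>\<^esub> M" unfolding Q_def RCOSETS_def by auto
  have "card Q * card M = card W"
    using group.lagrange[OF grpW normal_imp_subgroup[OF MnW]] unfolding Q order_def by simp
  then have cQ: "card Q = q ^ n" using n cM by simp
  have finQ: "finite Q" unfolding Q_def using finW by simp
  have MQ: "M \<in> Q" unfolding Q_def using M.rcos_const[OF is_group M.one_closed] W.one_closed by blast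
  define E where "E = Q - {M}"
  have "card E = q ^ n - 1" unfolding E_def using MQ finQ cQ by simp
  moreover have "\<not> q dvd q ^ n - 1"
  proof
    assume "q dvd q ^ n - 1"
    moreover have "q dvd q ^ n" using n0 by simp
    moreover have "q ^ n \<ge> 1" using q by (simp add: prime_gt_0_nat Suc_leI)
    ultimately have "q dvd 1" using dvd_diff_nat[of q "q ^ n" "q ^ n - 1"] by simp
    then show False using q not_prime_unit by blast
  qed
  ultimately have nd: "\<not> q dvd card E" by simp
  have Wc: "x \<in> carrier G" if "x \<in> W" for x using that by auto
  define act where "act x c = x <# c #> inv x" for x c
  have act: "act x (M #> w) = M #> (x \<otimes> w \<otimes> inv x)" if "x \<in> carrier G" "w \<in> carrier G" for x w
  proof -
    have "act x (M #> w) = x <# (M #> w) #> inv x" unfolding act_def ..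
    also have "x <# (M #> w) = (x <# M) #> w" using coset_assoc that M.subset by simp
    also have "\<dots> = (M #> x) #> w" using M.coset_eq that by simp
    finally show ?thesis using that M.subset by (simp add: coset_mult_assoc)
  qed
  have "\<exists>e\<in>E. \<forall>x\<in>carrier (G\<lparr>carrier := W\<rparr>). act x e = e"
  proof (rule group.fixed_point_exists[OF grpW _ _ _ _ _ normal_imp_subgroup[OF MnW] _ q _ nd])
    show "finite (carrier (G\<lparr>carrier := W\<rparr>))" "finite E" using finW finQ E_def by auto
    show "order (G\<lparr>carrier := W\<rparr>) = card M * q ^ n" using n by (simp add: order_def)
    show "act x e \<in> E" if x: "x \<in> carrier (G\<lparr>carrier := W\<rparr>)" and e: "e \<in> E" for x e
    proof -
      obtain w where w: "w \<in> W" "e = M #> w" "M #> w \<noteq> M" using e unfolding E_def Q_def by blast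
      have xc: "x \<in> W" using x by simp
      have "w \<notin> M" using w M.coset_eq_kernel_iff Wc by blast
      have "x \<otimes> w \<otimes> inv x \<notin> M"
      proof
        assume "x \<otimes> w \<otimes> inv x \<in> M"
        then have "inv x \<otimes> (x \<otimes> w \<otimes> inv x) \<otimes> x \<in> M" using M.inv_op_closed1 xc Wc by blast
        then show False using \<open>w \<notin> M\<close> Wc[OF xc] Wc[OF w(1)] by (simp add: m_assoc inv_cancel_left)
      qed
      then have "M #> (x \<otimes> w \<otimes> inv x) \<noteq> M"
        using M.coset_eq_kernel_iff[of "x \<otimes> w \<otimes> inv x"] Wc[OF xc] Wc[OF w(1)] by simp
      moreover have "M #> (x \<otimes> w \<otimes> inv x) \<in> Q" unfolding Q_def using w xc by blast
      ultimately show ?thesis unfolding E_def w(2) act[OF Wc[OF xc] Wc[OF w(1)]] by blast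
    qed
    show "act \<one>\<^bsub>G\<lparr>carrier := W\<rparr>\<^esub> e = e" if e: "e \<in> E" for e
    proof -
      obtain w where w: "w \<in> W" "e = M #> w" "M #> w \<noteq> M" using e unfolding E_def Q_def by blast
      show ?thesis unfolding w(2) using act[OF one_closed Wc[OF w(1)]] Wc[OF w(1)] by simp
    qed
    show "act (x \<otimes>\<^bsub>G\<lparr>carrier := W\<rparr>\<^esub> y) e = act x (act y e)"
      if xy: "x \<in> carrier (G\<lparr>carrier := W\<rparr>)" "y \<in> carrier (G\<lparr>carrier := W\<rparr>)" and e: "e \<in> E" for x y e
    proof -
      obtain w where w: "w \<in> W" "e = M #> w" "M #> w \<noteq> M" using e unfolding E_def Q_def by blast
      have c: "x \<in> carrier G" "y \<in> carrier G" "w \<in> carrier G" using xy w by auto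
      then show ?thesis unfolding w(2) by (simp add: act m_assoc inv_mult_group)
    qed
    show "act m e = e" if m: "m \<in> M" and e: "e \<in> E" for m e
    proof -
      obtain w where w: "w \<in> W" "e = M #> w" "M #> w \<noteq> M" using e unfolding E_def Q_def by blast
      have c: "m \<in> carrier G" "w \<in> carrier G" using m w by auto
      have "M #> (m \<otimes> w \<otimes> inv m) = M #> w"
      proof -
        have "m \<otimes> w \<otimes> inv m = m \<otimes> (w \<otimes> inv m \<otimes> inv w) \<otimes> w" using c by (simp add: m_assoc inv_cancel_left)
        moreover have "m \<otimes> (w \<otimes> inv m \<otimes> inv w) \<in> M" using m c M.inv_op_closed2 by simp
        ultimately show ?thesis using c coset_mult_assoc[OF M.subset] coset_join2[OF _ M.is_subgroup]
          by (metis M.mem_carrier)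
      qed
      then show ?thesis unfolding w(2) act[OF c] .
    qed
  qed
  then obtain z where z: "z \<in> W" "M #> z \<noteq> M" "\<And>x. x \<in> W \<Longrightarrow> act x (M #> z) = M #> z"
    unfolding E_def Q_def by auto
  have zc: "z \<in> carrier G" using z Wc by blast
  have "x \<otimes> z \<otimes> inv x \<otimes> inv z \<in> M" if x: "x \<in> W" for x
  proof -
    have "M #> (x \<otimes> z \<otimes> inv x) = M #> z" using z(3)[OF x] act Wc x zc by simp
    then have "x \<otimes> z \<otimes> inv x \<in> M #> z" using rcos_self[OF _ M.is_subgroup, of "x \<otimes> z \<otimes> inv x"] Wc[OF x] zc by simp
    then show ?thesis using M.rcos_module_imp[OF is_group zc] by blast
  qed
  moreover have "z \<notin> M" using z(2) M.coset_eq_kernel_iff zc by blast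
  ultimately show thesis using that z(1) by blast
qed

section \<open>Relative central series and the nilpotent residual\<close>

text \<open>
  The lower central series of the subgroup \<open>W\<close>, formed with the operations of the ambient
  group. Thus \<open>W / M\<close> is nilpotent if and only if some term lies in \<open>M\<close>.
\<close>
fun relative_lcs :: "('a, 'b) monoid_scheme \<Rightarrow> 'a set \<Rightarrow> nat \<Rightarrow> 'a set" where
  "relative_lcs G W 0 = W"
| "relative_lcs G W (Suc n) =
     generate G (\<Union>x\<in>W. \<Union>y\<in>relative_lcs G W n. {x \<otimes>\<^bsub>G\<^esub> y \<otimes>\<^bsub>G\<^esub> inv\<^bsub>G\<^esub> x \<otimes>\<^bsub>G\<^esub> inv\<^bsub>G\<^esub> y})"

text \<open>
  An upper central series that starts at \<open>M\<close>. Its terms are the elements of the whole group,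
  not only of \<open>K\<close>, that are centralized by \<open>K\<close> modulo the preceding term; so they are normal
  subgroups as soon as \<open>K\<close> and \<open>M\<close> are.
\<close>
fun relative_ucs :: "('a, 'b) monoid_scheme \<Rightarrow> 'a set \<Rightarrow> 'a set \<Rightarrow> nat \<Rightarrow> 'a set" where
  "relative_ucs G K M 0 = M"
| "relative_ucs G K M (Suc n) = centralizer_mod G K (relative_ucs G K M n)"

text \<open>
  The iterates of this map on the whole group form the lower Fitting series. Being an
  intersection, the residual lies in every \<open>M\<close> for which \<open>W / M\<close> is nilpotent.
\<close>
definition nilpotent_residual :: "('a, 'b) monoid_scheme \<Rightarrow> 'a set \<Rightarrow> 'a set" where
  "nilpotent_residual G W = (\<Inter>n. relative_lcs G W n)"

lemma (in group) relative_lcs_subset: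
  assumes "subgroup W G" shows "relative_lcs G W n \<subseteq> W"
proof (induction n)
  case (Suc n)
  interpret W: subgroup W G by fact
  show ?case unfolding relative_lcs.simps
    by (rule generate_subgroup_incl[OF _ assms]) (use Suc in auto)
qed simp

lemma (in group) lower_central_series_eq_relative_lcs:
  assumes "subgroup W G"
  shows "lower_central_series (G\<lparr>carrier := W\<rparr>) n = relative_lcs G W n"
proof (induction n)
  case (Suc n)
  interpret W: subgroup W G by fact
  have sub: "relative_lcs G W n \<subseteq> W" by (rule relative_lcs_subset[OF assms])
  have eq: "(\<Union>x\<in>W. \<Union>y\<in>relative_lcs G W n. {x \<otimes> y \<otimes> inv\<^bsub>G\<lparr>carrier := W\<rparr>\<^esub> x \<otimes> inv\<^bsub>G\<lparr>carrier := W\<rparr>\<^esub> y}) =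
    (\<Union>x\<in>W. \<Union>y\<in>relative_lcs G W n. {x \<otimes> y \<otimes> inv x \<otimes> inv y})"
    by (intro SUP_cong refl) (use sub assms in auto)
  have "(\<Union>x\<in>W. \<Union>y\<in>relative_lcs G W n. {x \<otimes> y \<otimes> inv x \<otimes> inv y}) \<subseteq> W" using sub by auto
  from generate_consistent[OF this assms] show ?case
    by (simp only: lower_central_series.simps relative_lcs.simps Suc eq partial_object.simps monoid.simps)
      (simp add: eq)
qed simp

lemma (in group) relative_lcs_normal:
  assumes "W \<lhd> G" shows "relative_lcs G W n \<lhd> G"
proof (induction n)
  case 0 show ?case using assms by simp
next
  case (Suc n)
  interpret W: normal W G by fact
  interpret L: normal "relative_lcs G W n" G by fact
  show ?case unfolding relative_lcs.simps
  proof (rule normal_generateI)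
    show "(\<Union>x\<in>W. \<Union>y\<in>relative_lcs G W n. {x \<otimes> y \<otimes> inv x \<otimes> inv y}) \<subseteq> carrier G" by auto
    fix h g assume h: "h \<in> (\<Union>x\<in>W. \<Union>y\<in>relative_lcs G W n. {x \<otimes> y \<otimes> inv x \<otimes> inv y})" and g: "g \<in> carrier G"
    then obtain x y where xy: "x \<in> W" "y \<in> relative_lcs G W n" "h = x \<otimes> y \<otimes> inv x \<otimes> inv y" by blast
    have c: "x \<in> carrier G" "y \<in> carrier G" using xy by auto
    have "g \<otimes> h \<otimes> inv g = (g \<otimes> x \<otimes> inv g) \<otimes> (g \<otimes> y \<otimes> inv g) \<otimes> inv (g \<otimes> x \<otimes> inv g) \<otimes> inv (g \<otimes> y \<otimes> inv g)"
      unfolding xy(3) using c g by (simp add: m_assoc inv_mult_group inv_cancel_left)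
    moreover have "g \<otimes> x \<otimes> inv g \<in> W" "g \<otimes> y \<otimes> inv g \<in> relative_lcs G W n"
      using xy g W.inv_op_closed2 L.inv_op_closed2 by auto
    ultimately show "g \<otimes> h \<otimes> inv g \<in> (\<Union>x\<in>W. \<Union>y\<in>relative_lcs G W n. {x \<otimes> y \<otimes> inv x \<otimes> inv y})" by blast
  qed
qed

lemma (in group) relative_lcs_decreasing:
  assumes "W \<lhd> G" "m \<le> n" shows "relative_lcs G W n \<subseteq> relative_lcs G W m"
proof (rule lift_Suc_antimono_le[OF _ assms(2)])
  fix n
  interpret W: normal W G by fact
  interpret L: normal "relative_lcs G W n" G by (rule relative_lcs_normal[OF assms(1)])
  show "relative_lcs G W (Suc n) \<subseteq> relative_lcs G W n"
    unfolding relative_lcs.simps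
    by (rule generate_subgroup_incl[OF _ L.is_subgroup]) (auto simp: L.inv_op_closed2)
qed

lemma (in group) relative_lcs_mono:
  assumes "V \<subseteq> W" shows "relative_lcs G V n \<subseteq> relative_lcs G W n"
proof (induction n)
  case (Suc n)
  show ?case unfolding relative_lcs.simps
    by (rule mono_generate) (use assms Suc in blast)
qed (use assms in simp)

lemma (in group_hom) relative_lcs_image:
  assumes "subgroup W G" shows "relative_lcs H (h ` W) n = h ` relative_lcs G W n"
proof (induction n)
  case (Suc n)
  interpret W: subgroup W G by fact
  have sub: "relative_lcs G W n \<subseteq> W" by (rule G.relative_lcs_subset[OF assms])
  have c: "h (x \<otimes> y \<otimes> inv x \<otimes> inv y) = h x \<otimes>\<^bsub>H\<^esub> h y \<otimes>\<^bsub>H\<^esub> inv\<^bsub>H\<^esub> h x \<otimes>\<^bsub>H\<^esub> inv\<^bsub>H\<^esub> h y"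
    if "x \<in> W" "y \<in> relative_lcs G W n" for x y
    using that sub by (intro hom_commutator) auto
  have "(\<Union>x\<in>h ` W. \<Union>y\<in>h ` relative_lcs G W n. {x \<otimes>\<^bsub>H\<^esub> y \<otimes>\<^bsub>H\<^esub> inv\<^bsub>H\<^esub> x \<otimes>\<^bsub>H\<^esub> inv\<^bsub>H\<^esub> y})
    = h ` (\<Union>x\<in>W. \<Union>y\<in>relative_lcs G W n. {x \<otimes> y \<otimes> inv x \<otimes> inv y})"
    unfolding image_UN UN_simps(10) image_insert image_empty
    by (intro SUP_cong refl) (simp only: c)
  moreover have "(\<Union>x\<in>W. \<Union>y\<in>relative_lcs G W n. {x \<otimes> y \<otimes> inv x \<otimes> inv y}) \<subseteq> carrier G"
    using sub by auto
  ultimately show ?case unfolding relative_lcs.simps Suc using generate_img by simp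
qed simp

lemma (in group) relative_ucs_normal:
  assumes "K \<lhd> G" "M \<lhd> G" shows "relative_ucs G K M n \<lhd> G"
  by (induction n) (use assms centralizer_mod_normal in auto)

lemma (in group) relative_ucs_contains:
  assumes "K \<lhd> G" "M \<lhd> G" shows "M \<subseteq> relative_ucs G K M n"
proof (induction n)
  case (Suc n)
  then show ?case
    using normal.subset_centralizer_mod[OF relative_ucs_normal[OF assms]] subgroup.subset[OF normal_imp_subgroup[OF assms(1)]]
    by (metis relative_ucs.simps(2) subset_trans)
qed simp

lemma (in group) relative_lcs_imp_ucs:
  assumes K: "K \<lhd> G" and "relative_lcs G K n \<subseteq> M"
  shows "K \<subseteq> relative_ucs G K M n"
proof -
  interpret K: normal K G by fact
  have "relative_lcs G K (n - i) \<subseteq> relative_ucs G K M i" if "i \<le> n" for i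
    using that
  proof (induction i)
    case 0 then show ?case using assms by simp
  next
    case (Suc i)
    have s: "n - i = Suc (n - Suc i)" using Suc by simp
    show ?case
    proof
      fix c assume c: "c \<in> relative_lcs G K (n - Suc i)"
      have "x \<otimes> c \<otimes> inv x \<otimes> inv c \<in> relative_ucs G K M i" if "x \<in> K" for x
      proof -
        have "x \<otimes> c \<otimes> inv x \<otimes> inv c \<in> relative_lcs G K (n - i)"
          unfolding s relative_lcs.simps by (rule generate.incl) (use that c in blast)
        then show ?thesis using Suc by auto
      qed
      moreover have "c \<in> carrier G" using c relative_lcs_subset[OF K.is_subgroup] K.subset by blast
      ultimately show "c \<in> relative_ucs G K M (Suc i)" by (simp add: centralizer_mod_def)
    qed
  qed
  from this[of n] show ?thesis by simp
qed

text \<open>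
  Central elements of the section raise \<open>M\<close> to a larger normal subgroup \<open>Z\<close> that \<open>W\<close>
  centralizes modulo \<open>M\<close>. The induction descends on the order of the section.
\<close>
lemma (in group) power_torsion_imp_nilpotent_over:
  assumes fin: "finite (carrier G)" and q: "Factorial_Ring.prime q"
    and M: "M \<lhd> G" and W: "W \<lhd> G" and MW: "M \<subseteq> W" and tor: "torsion_over G (powers_of q) M W"
  shows "\<exists>n. relative_lcs G W n \<subseteq> M"
  using M MW tor
proof (induction "card W - card M" arbitrary: M rule: less_induct)
  case (less M)
  show ?case
  proof (cases "M = W")
    case True
    then have "relative_lcs G W 0 \<subseteq> M" by simp
    then show ?thesis by blast
  next
    case False
    interpret M: normal M G by (rule less.prems)
    interpret W: normal W G by fact
    define Z where "Z = W \<inter> centralizer_mod G W M"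
    have Zn: "Z \<lhd> G" unfolding Z_def by (rule normal_subgroup_intersect[OF W centralizer_mod_normal[OF less.prems(1) W]])
    have MZ: "M \<subseteq> Z" unfolding Z_def using M.subset_centralizer_mod[OF W.subset] less.prems by blast
    obtain z where z: "z \<in> W" "z \<notin> M" "\<And>x. x \<in> W \<Longrightarrow> x \<otimes> z \<otimes> inv x \<otimes> inv z \<in> M"
      using central_element_mod_exists[OF fin q less.prems(1) W less.prems(2) False less.prems(3)] by blast
    then have "z \<in> Z" unfolding Z_def centralizer_mod_def by auto
    then have "M \<subset> Z" using MZ z by blast
    have ZW: "Z \<subseteq> W" unfolding Z_def by blast
    have finW: "finite W" using fin W.subset finite_subset by blast
    have "card M < card Z" using psubset_card_mono[OF finite_subset[OF ZW finW] \<open>M \<subset> Z\<close>] .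
    moreover have "card Z \<le> card W" using card_mono[OF finW ZW] .
    ultimately have "card W - card Z < card W - card M" by linarith
    from less.hyps[OF this Zn ZW] torsion_over_mono[OF less.prems(3) subset_refl MZ]
    obtain n where n: "relative_lcs G W n \<subseteq> Z" by blast
    have "relative_lcs G W (Suc n) \<subseteq> M"
      unfolding relative_lcs.simps
      by (rule generate_subgroup_incl[OF _ M.is_subgroup]) (use n in \<open>auto simp: Z_def centralizer_mod_def\<close>)
    then show ?thesis by blast
  qed
qed

text \<open>
  The intersection of the decreasing series is attained, because \<open>W\<close> is finite; so \<open>W\<close> is
  nilpotent modulo its residual.
\<close>
lemma (in group) nilpotent_residual_eq:
  assumes fin: "finite (carrier G)" and W: "W \<lhd> G"
  shows "\<exists>n. nilpotent_residual G W = relative_lcs G W n"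
proof -
  define R where "R = nilpotent_residual G W"
  interpret W: normal W G by fact
  have finW: "finite W" using fin W.subset finite_subset by blast
  have "\<forall>x\<in>W - R. \<exists>n. x \<notin> relative_lcs G W n" unfolding R_def nilpotent_residual_def by blast
  then obtain f where f: "\<And>x. x \<in> W - R \<Longrightarrow> x \<notin> relative_lcs G W (f x)" by metis
  define n where "n = Max (insert 0 (f ` (W - R)))"
  have "relative_lcs G W n \<subseteq> R"
  proof
    fix x assume x: "x \<in> relative_lcs G W n"
    show "x \<in> R"
    proof (rule ccontr)
      assume nR: "x \<notin> R"
      have "x \<in> W" using x relative_lcs_subset[OF W.is_subgroup] by blast
      then have xW: "x \<in> W - R" using nR by blast
      then have "f x \<le> n" unfolding n_def using finW by simp
      then show False using f[OF xW] relative_lcs_decreasing[OF W] x by blast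
    qed
  qed
  moreover have "R \<subseteq> relative_lcs G W n" unfolding R_def nilpotent_residual_def by blast
  ultimately show ?thesis unfolding R_def by blast
qed

lemma (in group) nilpotent_residual_normal:
  assumes "finite (carrier G)" "W \<lhd> G" shows "nilpotent_residual G W \<lhd> G"
  using nilpotent_residual_eq[OF assms] relative_lcs_normal[OF assms(2)] by metis

lemma nilpotent_residual_subset: "nilpotent_residual G W \<subseteq> relative_lcs G W n"
  unfolding nilpotent_residual_def by blast

lemma (in group) lower_fitting_normal:
  assumes "finite (carrier G)" shows "(nilpotent_residual G ^^ n) (carrier G) \<lhd> G"
  by (induction n) (use nilpotent_residual_normal[OF assms] normal_self in auto)

lemma (in group) lower_fitting_subset_derived:
  "(nilpotent_residual G ^^ n) (carrier G) \<subseteq> (derived G ^^ n) (carrier G)"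
proof (induction n)
  case (Suc n)
  have "relative_lcs G W 1 = derived G W" for W by (simp add: derived_def)
  then have "nilpotent_residual G W \<subseteq> derived G W" for W using nilpotent_residual_subset by metis
  then show ?case using mono_derived[OF Suc] by (metis comp_apply funpow.simps(2) subset_trans)
qed simp

text \<open>
  The elements of order prime to \<open>q\<close> in a nilpotent normal subgroup \<open>K\<close> act trivially on the
  \<open>q\<close>-group \<open>N / M\<close>. A commutator \<open>c\<close> of such an element \<open>x\<close> with an element of \<open>N\<close> lies in
  \<open>K\<close>, hence in some term of the upper central series of \<open>K\<close> above \<open>M\<close>. It also lies in \<open>N\<close>,
  so its order modulo \<open>M\<close> is prime to that of \<open>x\<close>, and modulo the next lower term it commutes
  with \<open>x\<close>. This pushes \<open>c\<close> down the series into \<open>M\<close>.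
\<close>
lemma (in group) coprime_nilpotent_mem:
  assumes K: "K \<lhd> G" and M: "M \<lhd> G" and N: "N \<lhd> G" and nil: "relative_lcs G K n \<subseteq> M"
    and tor: "torsion_over G (powers_of q) M N" and cent: "centralizer_mod G N M \<subseteq> N"
    and x: "x \<in> K" and m: "x [^] m \<in> M" and cop: "coprime m q"
  shows "x \<in> M"
proof -
  interpret K: normal K G by fact
  interpret M: normal M G by fact
  interpret N: normal N G by fact
  have xc: "x \<in> carrier G" using x by auto
  have "y \<otimes> x \<otimes> inv y \<otimes> inv x \<in> M" if y: "y \<in> N" for y
  proof -
    have yc: "y \<in> carrier G" using y by auto
    let ?c = "y \<otimes> x \<otimes> inv y \<otimes> inv x"
    have cK: "?c \<in> K" using x yc K.inv_op_closed2 by auto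
    have "x \<otimes> inv y \<otimes> inv x \<in> N" using y xc N.inv_op_closed2 by auto
    then have "y \<otimes> (x \<otimes> inv y \<otimes> inv x) \<in> N" using y by auto
    then have cN: "?c \<in> N" using xc yc by (simp add: m_assoc)
    obtain k where k: "k \<in> powers_of q" "?c [^] k \<in> M" using torsion_overD[OF tor cN] .
    have copk: "coprime m k" using k(1) cop unfolding powers_of_def by auto
    have "?c \<in> relative_ucs G K M i \<Longrightarrow> ?c \<in> M" for i
    proof (induction i)
      case (Suc i)
      have n: "relative_ucs G K M i \<lhd> G" by (rule relative_ucs_normal[OF K M])
      have MU: "M \<subseteq> relative_ucs G K M i" by (rule relative_ucs_contains[OF K M])
      have "x \<otimes> ?c \<otimes> inv x \<otimes> inv ?c \<in> relative_ucs G K M i"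
        using Suc.prems x by (simp add: centralizer_mod_def)
      then have "?c \<in> relative_ucs G K M i"
        using mod_commutator_trivial_of_coprime[OF n xc yc refl _ _ _ copk] m k(2) MU by blast
      then show ?case using Suc.IH by blast
    qed simp
    then show ?thesis using relative_lcs_imp_ucs[OF K nil] cK by blast
  qed
  then have "x \<in> N" using cent xc unfolding centralizer_mod_def by blast
  then obtain k where k: "k \<in> powers_of q" "x [^] k \<in> M" using torsion_overD[OF tor] by blast
  have "coprime m k" using k(1) cop unfolding powers_of_def by auto
  then show ?thesis using mem_of_coprime_pows[OF M.is_subgroup xc m k(2)] by blast
qed

text \<open>
  A normal subgroup that is nilpotent modulo \<open>M1\<close> is generated by elements of order prime to
  \<open>q1\<close>, which lie in \<open>M1\<close>, and \<open>q1\<close>-elements, which have order prime to \<open>q2\<close> and therefore lie in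
  \<open>M2\<close>.
\<close>
lemma (in group) nilpotent_below_next_layer:
  assumes fin: "finite (carrier G)" and K: "K \<lhd> G" and nil: "relative_lcs G K n \<subseteq> M1"
    and M1: "M1 \<lhd> G" and N1: "N1 \<lhd> G" and M2: "M2 \<lhd> G" and N2: "N2 \<lhd> G" and M12: "M1 \<subseteq> M2"
    and t1: "torsion_over G (powers_of q1) M1 N1" and t2: "torsion_over G (powers_of q2) M2 N2"
    and c1: "centralizer_mod G N1 M1 \<subseteq> N1" and c2: "centralizer_mod G N2 M2 \<subseteq> N2"
    and q: "Factorial_Ring.prime q1" "Factorial_Ring.prime q2" "q1 \<noteq> q2"
  shows "K \<subseteq> M2"
proof
  fix x assume x: "x \<in> K"
  interpret K: normal K G by fact
  have xc: "x \<in> carrier G" using x by auto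
  have "order G \<noteq> 0" using fin order_gt_0_iff_finite by auto
  moreover have "\<not> is_unit q1" using q(1) not_prime_unit by blast
  ultimately obtain e m where m: "order G = q1 ^ e * m" "\<not> q1 dvd m"
    using multiplicity_decompose' by metis
  have cop: "coprime m q1" using m(2) q(1) by (metis coprime_commute prime_imp_coprime)
  have one: "x [^] (q1 ^ e * m) = \<one>" using pow_order_eq_1[OF xc] m(1) by simp
  have "x [^] (q1 ^ e) \<in> M1"
  proof (rule coprime_nilpotent_mem[OF K M1 N1 nil t1 c1 _ _ cop])
    show "x [^] (q1 ^ e) \<in> K" using subgroup_nat_pow_closed[OF K.is_subgroup x] .
    show "(x [^] (q1 ^ e)) [^] m \<in> M1"
      using one xc subgroup.one_closed[OF normal_imp_subgroup[OF M1]] by (simp add: nat_pow_pow)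
  qed
  then have a: "x [^] (q1 ^ e) \<in> M2" using M12 by blast
  have nil2: "relative_lcs G K n \<subseteq> M2" using nil M12 by blast
  have b: "x [^] m \<in> M2"
  proof (rule coprime_nilpotent_mem[OF K M2 N2 nil2 t2 c2])
    show "x [^] m \<in> K" using subgroup_nat_pow_closed[OF K.is_subgroup x] .
    show "(x [^] m) [^] (q1 ^ e) \<in> M2"
      using one xc subgroup.one_closed[OF normal_imp_subgroup[OF M2]] by (simp add: nat_pow_pow mult.commute)
    show "coprime (q1 ^ e) q2" using q by (simp add: primes_coprime)
  qed
  show "x \<in> M2"
    using mem_of_coprime_pows[OF normal_imp_subgroup[OF M2] xc a b] cop by (simp add: coprime_commute)
qed

section \<open>Upper and lower Fitting series\<close>
lemma (in group_hom) normal_preimage: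
  assumes "K \<lhd> H" shows "{x \<in> carrier G. h x \<in> K} \<lhd> G"
proof -
  interpret K: normal K H by fact
  show ?thesis
  proof (rule G.normal_invI)
    show "subgroup {x \<in> carrier G. h x \<in> K} G" by (rule subgroup.intro) auto
    show "x \<otimes> k \<otimes> inv x \<in> {x \<in> carrier G. h x \<in> K}"
      if "x \<in> carrier G" "k \<in> {x \<in> carrier G. h x \<in> K}" for x k
      using that K.inv_op_closed2 by auto
  qed
qed

lemma (in group) fitting_subgroup_normal: "fitting_subgroup G \<lhd> G"
  unfolding fitting_subgroup_def
proof (rule normal_generateI)
  show "\<Union> {N. N \<lhd> G \<and> nilpotent_group (G\<lparr>carrier := N\<rparr>)} \<subseteq> carrier G"
    using normal_imp_subgroup subgroup.subset by blast
  fix h g assume "h \<in> \<Union> {N. N \<lhd> G \<and> nilpotent_group (G\<lparr>carrier := N\<rparr>)}" "g \<in> carrier G"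
  then show "g \<otimes> h \<otimes> inv g \<in> \<Union> {N. N \<lhd> G \<and> nilpotent_group (G\<lparr>carrier := N\<rparr>)}"
    using normal.inv_op_closed2 by fast
qed

lemma (in group) fitting_series_normal: "fitting_series G n \<lhd> G"
proof (induction n)
  case 0 show ?case using one_is_normal by simp
next
  case (Suc n)
  interpret F: normal "fitting_series G n" G by fact
  interpret q: group_hom G "G Mod fitting_series G n" "\<lambda>x. fitting_series G n #> x" by (rule F.quotient_map_hom)
  show ?case using q.normal_preimage[OF q.H.fitting_subgroup_normal] by simp
qed

lemma (in group) nilpotent_group_subgroup_iff:
  assumes "subgroup W G"
  shows "nilpotent_group (G\<lparr>carrier := W\<rparr>) \<longleftrightarrow> (\<exists>n. relative_lcs G W n = {\<one>})"
  unfolding nilpotent_group_def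
  using lower_central_series_eq_relative_lcs[OF assms] subgroup_imp_group[OF assms] by simp

text \<open>
  Together with the lemma after it, this describes the step of the upper Fitting series without
  quotient groups: the next term is generated by the normal subgroups of \<open>G\<close> that are nilpotent
  modulo the present one.
\<close>
lemma (in group) fitting_series_Suc_contains:
  assumes W: "W \<lhd> G" and nil: "relative_lcs G W n \<subseteq> fitting_series G j"
  shows "W \<subseteq> fitting_series G (Suc j)"
proof -
  define F where "F = fitting_series G j"
  interpret F: normal F G unfolding F_def by (rule fitting_series_normal)
  interpret W: normal W G by fact
  interpret L: normal "relative_lcs G W n" G by (rule relative_lcs_normal[OF W])
  interpret q: group_hom G "G Mod F" "\<lambda>x. F #> x" by (rule F.quotient_map_hom)
  let ?W = "(\<lambda>x. F #> x) ` W"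
  have n: "?W \<lhd> G Mod F"
    by (rule W.surj_hom_normal_subgroup[OF q.group_hom_axioms]) (simp add: carrier_FactGroup)
  have "relative_lcs (G Mod F) ?W n = (\<lambda>x. F #> x) ` relative_lcs G W n"
    by (rule q.relative_lcs_image[OF W.is_subgroup])
  also have "\<dots> = {\<one>\<^bsub>G Mod F\<^esub>}"
  proof -
    have "F #> x = F" if "x \<in> relative_lcs G W n" for x
      using that nil F.coset_eq_kernel_iff F.subset unfolding F_def by blast
    moreover have "relative_lcs G W n \<noteq> {}" using L.one_closed by blast
    ultimately show ?thesis by auto
  qed
  finally have "nilpotent_group ((G Mod F)\<lparr>carrier := ?W\<rparr>)"
    using q.H.nilpotent_group_subgroup_iff[OF normal_imp_subgroup[OF n]] by blast
  then have "?W \<subseteq> fitting_subgroup (G Mod F)"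
    unfolding fitting_subgroup_def using n by (blast intro: generate.incl)
  then have "\<forall>x\<in>W. x \<in> carrier G \<and> F #> x \<in> fitting_subgroup (G Mod F)" using W.subset by blast
  then show ?thesis unfolding F_def fitting_series.simps by blast
qed

lemma (in group) fitting_series_Suc_subset:
  assumes M: "M \<lhd> G" and FM: "fitting_series G j \<subseteq> M"
    and all: "\<And>K n. K \<lhd> G \<Longrightarrow> relative_lcs G K n \<subseteq> fitting_series G j \<Longrightarrow> K \<subseteq> M"
  shows "fitting_series G (Suc j) \<subseteq> M"
proof
  define F where "F = fitting_series G j"
  interpret F: normal F G unfolding F_def by (rule fitting_series_normal)
  interpret M: normal M G by fact
  interpret q: group_hom G "G Mod F" "\<lambda>x. F #> x" by (rule F.quotient_map_hom)
  have sM: "subgroup ((\<lambda>x. F #> x) ` M) (G Mod F)" by (rule q.subgroup_img_is_subgroup[OF M.is_subgroup])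
  have "fitting_subgroup (G Mod F) \<subseteq> (\<lambda>x. F #> x) ` M"
    unfolding fitting_subgroup_def
  proof (rule q.H.generate_subgroup_incl[OF _ sM], rule Union_least)
    fix B assume "B \<in> {N. N \<lhd> G Mod F \<and> nilpotent_group ((G Mod F)\<lparr>carrier := N\<rparr>)}"
    then have B: "B \<lhd> G Mod F" and nB: "nilpotent_group ((G Mod F)\<lparr>carrier := B\<rparr>)" by auto
    define K where "K = {x \<in> carrier G. F #> x \<in> B}"
    have Kn: "K \<lhd> G" unfolding K_def by (rule q.normal_preimage[OF B])
    have BK: "B = (\<lambda>x. F #> x) ` K"
      using subgroup.subset[OF normal_imp_subgroup[OF B]] unfolding K_def carrier_FactGroup by auto
    obtain n where n: "relative_lcs (G Mod F) B n = {\<one>\<^bsub>G Mod F\<^esub>}"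
      using nB q.H.nilpotent_group_subgroup_iff[OF normal_imp_subgroup[OF B]] by blast
    have img: "(\<lambda>x. F #> x) ` relative_lcs G K n = {F}"
      using q.relative_lcs_image[OF normal_imp_subgroup[OF Kn], of n] n unfolding BK[symmetric] by simp
    have sub: "relative_lcs G K n \<subseteq> carrier G"
      by (rule subgroup.subset[OF normal_imp_subgroup[OF relative_lcs_normal[OF Kn]]])
    have "relative_lcs G K n \<subseteq> F"
    proof
      fix y assume y: "y \<in> relative_lcs G K n"
      then have "F #> y \<in> (\<lambda>x. F #> x) ` relative_lcs G K n" by (rule imageI)
      then have "F #> y = F" unfolding img by simp
      then show "y \<in> F" using F.coset_eq_kernel_iff[OF subsetD[OF sub y]] by simp
    qed
    then have "K \<subseteq> M" using all[OF Kn] unfolding F_def by blast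
    then show "B \<subseteq> (\<lambda>x. F #> x) ` M" unfolding BK by blast
  qed
  moreover fix x assume "x \<in> fitting_series G (Suc j)"
  ultimately have x: "x \<in> carrier G" "F #> x \<in> (\<lambda>x. F #> x) ` M" unfolding F_def by auto
  then obtain m where m: "m \<in> M" "F #> x = F #> m" by blast
  then have "x \<in> F #> m" using rcos_self[OF x(1) F.is_subgroup] by simp
  then obtain f where "f \<in> F" "x = f \<otimes> m" unfolding r_coset_def by blast
  then show "x \<in> M" using m FM unfolding F_def by auto
qed

text \<open>
  If the lower series ends at \<open>k\<close>, then its term with index \<open>k - j\<close> lies in the \<open>j\<close>-th term of
  the upper series.
\<close>
lemma (in group) fitting_series_eq_carrier:
  assumes fin: "finite (carrier G)" and L: "(nilpotent_residual G ^^ k) (carrier G) = {\<one>}"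
  shows "fitting_series G k = carrier G"
proof -
  have "(nilpotent_residual G ^^ (k - j)) (carrier G) \<subseteq> fitting_series G j" if "j \<le> k" for j
    using that
  proof (induction j)
    case 0 then show ?case using L by simp
  next
    case (Suc j)
    let ?W = "(nilpotent_residual G ^^ (k - Suc j)) (carrier G)"
    have W: "?W \<lhd> G" by (rule lower_fitting_normal[OF fin])
    obtain n where "nilpotent_residual G ?W = relative_lcs G ?W n" using nilpotent_residual_eq[OF fin W] by blast
    moreover have "k - j = Suc (k - Suc j)" using Suc by simp
    ultimately have "relative_lcs G ?W n \<subseteq> fitting_series G j" using Suc by simp
    then show ?case by (rule fitting_series_Suc_contains[OF W])
  qed
  from this[of k] show ?thesis
    using subgroup.subset[OF normal_imp_subgroup[OF fitting_series_normal]] by auto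
qed

text \<open>
  The lower Fitting series descends at least as fast as the derived series, so the minimum in
  the definition of the Fitting length is taken over a nonempty set.
\<close>
lemma (in group) fitting_series_reaches_carrier:
  assumes fin: "finite (carrier G)" and sol: "solvable G"
  shows "fitting_series G (fitting_length G) = carrier G"
proof -
  obtain n where n: "(derived G ^^ n) (carrier G) = {\<one>}"
    using sol solvable_iff_trivial_derived_seq by blast
  have "(nilpotent_residual G ^^ n) (carrier G) = {\<one>}"
    using lower_fitting_subset_derived[of n] n
      subgroup.one_closed[OF normal_imp_subgroup[OF lower_fitting_normal[OF fin]], of n] by auto
  then have "fitting_series G n = carrier G" by (rule fitting_series_eq_carrier[OF fin])
  then show ?thesis unfolding fitting_length_def by (rule LeastI)
qed

lemma (in group) lower_fitting_nontrivial:
  assumes fin: "finite (carrier G)" and k: "k < fitting_length G"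
  shows "\<not> (nilpotent_residual G ^^ k) (carrier G) \<subseteq> {\<one>}"
proof
  assume "(nilpotent_residual G ^^ k) (carrier G) \<subseteq> {\<one>}"
  then have "(nilpotent_residual G ^^ k) (carrier G) = {\<one>}"
    using subgroup.one_closed[OF normal_imp_subgroup[OF lower_fitting_normal[OF fin]], of k] by auto
  then have "fitting_series G k = carrier G" by (rule fitting_series_eq_carrier[OF fin])
  then have "fitting_length G \<le> k" unfolding fitting_length_def by (rule Least_le)
  then show False using k by simp
qed

section \<open>Towers\<close>

text \<open>
  A tower above \<open>B\<close> whose layers, from the bottom to the top, are \<open>q\<close>-sections for the primes
  \<open>q\<close> of the list. The gaps between the layers are arbitrary normal sections. This freedom makes
  it possible to omit layers and to intersect with subgroups.
\<close>
fun tower :: "('a, 'b) monoid_scheme \<Rightarrow> 'a set \<Rightarrow> nat list \<Rightarrow> bool" where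
  "tower G B [] \<longleftrightarrow> True"
| "tower G B (q # qs) \<longleftrightarrow> Factorial_Ring.prime q \<and>
     (\<exists>M N. M \<lhd> G \<and> N \<lhd> G \<and> B \<subseteq> M \<and> M \<subset> N \<and> torsion_over G (powers_of q) M N \<and>
        centralizer_mod G N M \<subseteq> N \<and> tower G N qs)"

lemma tower_ConsE:
  assumes "tower G B (q # qs)"
  obtains M N where "Factorial_Ring.prime q" "M \<lhd> G" "N \<lhd> G" "B \<subseteq> M" "M \<subset> N"
    "torsion_over G (powers_of q) M N" "centralizer_mod G N M \<subseteq> N" "tower G N qs"
  using assms unfolding tower.simps by (elim conjE exE)

lemma tower_ConsI:
  assumes "Factorial_Ring.prime q" "M \<lhd> G" "N \<lhd> G" "B \<subseteq> M" "M \<subset> N"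
    "torsion_over G (powers_of q) M N" "centralizer_mod G N M \<subseteq> N" "tower G N qs"
  shows "tower G B (q # qs)"
  unfolding tower.simps by (intro conjI exI) (fact assms)+

declare tower.simps(2) [simp del]

lemma tower_antimono:
  assumes t: "tower G B qs" and sub: "B' \<subseteq> B" shows "tower G B' qs"
proof (cases qs)
  case (Cons q qs')
  from t[unfolded Cons] show ?thesis unfolding Cons
  proof (rule tower_ConsE)
    fix M N assume a: "Factorial_Ring.prime q" "M \<lhd> G" "N \<lhd> G" "B \<subseteq> M" "M \<subset> N"
        "torsion_over G (powers_of q) M N" "centralizer_mod G N M \<subseteq> N" "tower G N qs'"
    show "tower G B' (q # qs')" by (rule tower_ConsI[OF a(1-3) subset_trans[OF sub a(4)] a(5-8)])
  qed
qed simp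

lemma tower_tl:
  assumes "tower G B (q # qs)" shows "tower G B qs"
  using assms
proof (rule tower_ConsE)
  fix M N assume "B \<subseteq> M" "M \<subset> N" "tower G N qs"
  then show ?thesis using tower_antimono[of G N qs B] by blast
qed

lemma tower_remdups_adj: "tower G B qs \<Longrightarrow> tower G B (remdups_adj qs)"
proof (induction qs arbitrary: B rule: remdups_adj.induct)
  case (3 x y xs)
  show ?case
  proof (cases "x = y")
    case True
    have "tower G B (x # xs)" using tower_tl[OF "3.prems"] True by simp
    then show ?thesis using "3.IH"(1)[OF True] True by simp
  next
    case False
    show ?thesis
      using "3.prems"
    proof (rule tower_ConsE)
      fix M N assume a: "Factorial_Ring.prime x" "M \<lhd> G" "N \<lhd> G" "B \<subseteq> M" "M \<subset> N"
        "torsion_over G (powers_of x) M N" "centralizer_mod G N M \<subseteq> N" "tower G N (y # xs)"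
      have "tower G N (remdups_adj (y # xs))" by (rule "3.IH"(2)[OF False a(8)])
      from tower_ConsI[OF a(1-7) this] show ?thesis using False by simp
    qed
  qed
qed simp_all

text \<open>
  A term of the upper Fitting series that lies below the first layer is followed by one that
  lies below the second layer.
\<close>
lemma (in group) tower_fitting_series_proper:
  assumes fin: "finite (carrier G)"
  shows "tower G B qs \<Longrightarrow> distinct_adj qs \<Longrightarrow> fitting_series G j \<subseteq> B \<Longrightarrow> i < length qs
    \<Longrightarrow> fitting_series G (j + i) \<noteq> carrier G"
proof (induction qs arbitrary: B i j)
  case (Cons q qs)
  from Cons.prems(1) obtain M1 N1 where 1: "Factorial_Ring.prime q" "M1 \<lhd> G" "N1 \<lhd> G" "B \<subseteq> M1" "M1 \<subset> N1"
    "torsion_over G (powers_of q) M1 N1" "centralizer_mod G N1 M1 \<subseteq> N1" "tower G N1 qs"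
    by (rule tower_ConsE)
  have FM: "fitting_series G j \<subseteq> M1" using Cons.prems(3) 1(4) by blast
  show ?case
  proof (cases i)
    case 0
    have "N1 \<subseteq> carrier G" using subgroup.subset[OF normal_imp_subgroup[OF 1(3)]] .
    then show ?thesis using 0 FM 1(5) by auto
  next
    case (Suc i')
    then obtain q' qs' where qs: "qs = q' # qs'" using Cons.prems(4) by (cases qs) auto
    from 1(8) obtain M2 N2 where 2: "Factorial_Ring.prime q'" "M2 \<lhd> G" "N2 \<lhd> G" "N1 \<subseteq> M2" "M2 \<subset> N2"
      "torsion_over G (powers_of q') M2 N2" "centralizer_mod G N2 M2 \<subseteq> N2" "tower G N2 qs'"
      unfolding qs by (rule tower_ConsE)
    have qq: "q \<noteq> q'" using Cons.prems(2) qs by simp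
    have M12: "M1 \<subseteq> M2" using 1(5) 2(4) by blast
    have "fitting_series G (Suc j) \<subseteq> M2"
    proof (rule fitting_series_Suc_subset[OF 2(2)])
      show "fitting_series G j \<subseteq> M2" using FM M12 by blast
      show "K \<subseteq> M2" if "K \<lhd> G" "relative_lcs G K n \<subseteq> fitting_series G j" for K n
        by (rule nilpotent_below_next_layer[OF fin that(1) _ 1(2,3) 2(2,3) M12 1(6) 2(6) 1(7) 2(7) 1(1) 2(1) qq])
          (use that(2) FM in blast)
    qed
    moreover have "tower G M2 qs" unfolding qs using tower_ConsI[OF 2(1-3) subset_refl 2(5-8)] .
    moreover have "distinct_adj qs" using Cons.prems(2) qs by simp
    moreover have "i' < length qs" using Cons.prems(4) Suc by simp
    ultimately have "fitting_series G (Suc j + i') \<noteq> carrier G" using Cons.IH by blast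
    then show ?thesis using Suc by simp
  qed
qed simp

lemma (in group) tower_length_le_fitting_length:
  assumes fin: "finite (carrier G)" and sol: "solvable G"
    and t: "tower G B qs" and d: "distinct_adj qs" and one: "\<one> \<in> B"
  shows "length qs \<le> fitting_length G"
proof (rule ccontr)
  assume "\<not> length qs \<le> fitting_length G"
  then have "fitting_series G (0 + fitting_length G) \<noteq> carrier G"
    using tower_fitting_series_proper[OF fin t d, of 0] one by simp
  then show False using fitting_series_reaches_carrier[OF fin sol] by simp
qed

text \<open>
  If \<open>O\<^sub>p(G / N)\<close> is trivial, then the \<open>q'\<close>-cores of \<open>G / N\<close> for the primes \<open>q \<noteq> p\<close> intersect
  trivially: an \<open>r\<close>-section just above \<open>N\<close> has \<open>r \<noteq> p\<close> and avoids the \<open>r'\<close>-core. Hence one of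
  these cores does not contain \<open>L\<close>.
\<close>
lemma (in group) next_layer_exists:
  assumes fin: "finite (carrier G)" and sol: "solvable G" and N: "N \<lhd> G"
    and core: "\<And>W. W \<lhd> G \<Longrightarrow> torsion_over G (powers_of p) N W \<Longrightarrow> W \<subseteq> N"
    and L: "L \<lhd> G" "\<not> L \<subseteq> N"
  obtains q M where "Factorial_Ring.prime q" "q \<noteq> p" "M \<lhd> G" "N \<subseteq> M"
    "torsion_over G (coprime_to q) N M"
    "\<And>W. W \<lhd> G \<Longrightarrow> torsion_over G (coprime_to q) N W \<Longrightarrow> W \<subseteq> M" "\<not> L \<subseteq> M"
proof -
  interpret N: normal N G by fact
  interpret L: normal L G by fact
  define W where "W = N <#> L"
  have W: "W \<lhd> G" unfolding W_def by (rule normal_subgroup_set_mult_closed[OF N L(1)])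
  have NW: "N \<subseteq> W"
  proof
    fix x assume x: "x \<in> N"
    then have "x \<otimes> \<one> \<in> W" unfolding W_def set_mult_def using L.one_closed by blast
    then show "x \<in> W" using x N.subset by auto
  qed
  have LW: "L \<subseteq> W"
  proof
    fix x assume x: "x \<in> L"
    then have "\<one> \<otimes> x \<in> W" unfolding W_def set_mult_def using N.one_closed by blast
    then show "x \<in> W" using x L.subset by auto
  qed
  have "N \<noteq> W" using LW L(2) by blast
  then obtain r Y where r: "Factorial_Ring.prime r" and Y: "Y \<lhd> G" "N \<subseteq> Y" "N \<noteq> Y" "Y \<subseteq> W"
    and tY: "torsion_over G (powers_of r) N Y"
    using abelian_torsion_section_exists[OF fin sol N W NW] by metis
  have rp: "r \<noteq> p" using core Y tY by blast
  obtain M where M: "M \<lhd> G" "N \<subseteq> M" "torsion_over G (coprime_to r) N M"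
    "\<And>W. W \<lhd> G \<Longrightarrow> torsion_over G (coprime_to r) N W \<Longrightarrow> W \<subseteq> M"
    using torsion_core_exists[OF fin N, of "coprime_to r"] coprime_to_closed by metis
  have "\<not> L \<subseteq> M"
  proof
    assume "L \<subseteq> M"
    have "W \<subseteq> M"
    proof
      fix x assume "x \<in> W"
      then obtain a b where "a \<in> N" "b \<in> L" "x = a \<otimes> b" unfolding W_def set_mult_def by blast
      then show "x \<in> M" using M(2) \<open>L \<subseteq> M\<close> subgroup.m_closed[OF normal_imp_subgroup[OF M(1)]] by blast
    qed
    obtain y where y: "y \<in> Y" "y \<notin> N" using Y by blast
    then have yM: "y \<in> M" using Y(4) \<open>W \<subseteq> M\<close> by blast
    have yc: "y \<in> carrier G" using y(1) subgroup.subset[OF normal_imp_subgroup[OF Y(1)]] by blast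
    obtain k where k: "k \<in> powers_of r" "y [^] k \<in> N" using torsion_overD[OF tY y(1)] .
    obtain l where l: "l \<in> coprime_to r" "y [^] l \<in> N" using torsion_overD[OF M(3) yM] .
    have "coprime l k" using k l unfolding powers_of_def coprime_to_def by auto
    then show False using mem_of_coprime_pows[OF N.is_subgroup yc l(2) k(2)] y by blast
  qed
  then show thesis using that r rp M by blast
qed

text \<open>
  One layer is used up for each term of the lower Fitting series. If the \<open>i\<close>-th term is not
  contained in the \<open>q'\<close>-core \<open>M\<close>, then the preceding term is not contained in the \<open>q\<close>-core \<open>P\<close>
  above it, since \<open>P / M\<close> is nilpotent and so the residual of \<open>P\<close> lies in \<open>M\<close>. The
  hypothesis on \<open>p\<close> forces the first prime of the tower to differ from \<open>p\<close>; it is inherited by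
  \<open>P\<close> and \<open>q\<close> because \<open>P\<close> is a full \<open>q\<close>-core.
\<close>
lemma (in group) tower_exists_above:
  assumes fin: "finite (carrier G)" and sol: "solvable G"
  shows "N \<lhd> G \<Longrightarrow> (\<And>W. W \<lhd> G \<Longrightarrow> torsion_over G (powers_of p) N W \<Longrightarrow> W \<subseteq> N)
    \<Longrightarrow> \<not> (nilpotent_residual G ^^ i) (carrier G) \<subseteq> N
    \<Longrightarrow> \<exists>qs. length qs = Suc i \<and> distinct_adj (p # qs) \<and> tower G N qs"
proof (induction i arbitrary: N p rule: less_induct)
  case (less i N p)
  let ?L = "\<lambda>i. (nilpotent_residual G ^^ i) (carrier G)"
  have Ln: "?L j \<lhd> G" for j by (rule lower_fitting_normal[OF fin])
  obtain q M where q: "Factorial_Ring.prime q" "q \<noteq> p" and M: "M \<lhd> G" and NM: "N \<subseteq> M"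
    and tM: "torsion_over G (coprime_to q) N M"
    and mM: "\<And>W. W \<lhd> G \<Longrightarrow> torsion_over G (coprime_to q) N W \<Longrightarrow> W \<subseteq> M" and LM: "\<not> ?L i \<subseteq> M"
    using next_layer_exists[OF fin sol less.prems(1) _ Ln less.prems(3), of p] less.prems(2) by metis
  obtain P where P: "P \<lhd> G" "M \<subseteq> P" and tP: "torsion_over G (powers_of q) M P"
    and mP: "\<And>W. W \<lhd> G \<Longrightarrow> torsion_over G (powers_of q) M W \<Longrightarrow> W \<subseteq> P"
    using torsion_core_exists[OF fin M, of "powers_of q"] powers_of_closed by metis
  have sub: "W \<subseteq> carrier G" if "W \<lhd> G" for W
    by (rule subgroup.subset[OF normal_imp_subgroup[OF that]])
  have cent: "centralizer_mod G P M \<subseteq> P"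
  proof (rule hall_higman[OF fin sol q(1) M P tP mP])
    fix W assume W: "W \<lhd> G" "torsion_over G (coprime_to q) M W"
    then show "W \<subseteq> M"
      using mM[OF W(1) torsion_over_trans[OF sub[OF W(1)] W(2) tM coprime_to_closed(2)]] by blast
  qed
  have "M \<noteq> P"
  proof
    assume "M = P"
    then have "centralizer_mod G M M \<subseteq> M" using cent by simp
    moreover have "centralizer_mod G M M = carrier G"
    proof -
      interpret M: normal M G by fact
      have "x \<otimes> c \<otimes> inv x \<otimes> inv c \<in> M" if x: "x \<in> M" and c: "c \<in> carrier G" for x c
      proof -
        have "c \<otimes> inv x \<otimes> inv c \<in> M" using x c M.inv_op_closed2 by simp
        then have "x \<otimes> (c \<otimes> inv x \<otimes> inv c) \<in> M" using x by simp
        then show ?thesis using x c M.subset by (simp add: m_assoc subset_iff)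
      qed
      then show ?thesis unfolding centralizer_mod_def by blast
    qed
    ultimately show False using LM sub[OF Ln[of i]] by blast
  qed
  then have MP: "M \<subset> P" using P by blast
  have "\<exists>qs. length qs = i \<and> distinct_adj (q # qs) \<and> tower G P qs"
  proof (cases i)
    case 0
    then show ?thesis by (intro exI[of _ "[]"]) simp
  next
    case (Suc i')
    have "\<not> ?L i' \<subseteq> P"
    proof
      assume LP: "?L i' \<subseteq> P"
      obtain n where n: "relative_lcs G P n \<subseteq> M"
        using power_torsion_imp_nilpotent_over[OF fin q(1) M P tP] by blast
      have "?L i \<subseteq> relative_lcs G (?L i') n" unfolding Suc by (simp add: nilpotent_residual_subset)
      also have "\<dots> \<subseteq> relative_lcs G P n" by (rule relative_lcs_mono[OF LP])
      finally show False using n LM by blast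
    qed
    moreover have "W \<subseteq> P" if W: "W \<lhd> G" "torsion_over G (powers_of q) P W" for W
      using mP[OF W(1) torsion_over_trans[OF sub[OF W(1)] W(2) tP powers_of_closed(2)]] by blast
    ultimately show ?thesis using less.IH[of i' P q] Suc P(1) by simp
  qed
  then obtain qs where qs: "length qs = i" "distinct_adj (q # qs)" "tower G P qs" by blast
  have "tower G N (q # qs)" by (rule tower_ConsI[OF q(1) M P(1) NM MP tP cent qs(3)])
  moreover have "distinct_adj (p # q # qs)" using qs(2) q(2) by simp
  ultimately show ?case using qs(1) by (intro exI[of _ "q # qs"]) simp
qed

lemma (in group) tower_exists:
  assumes fin: "finite (carrier G)" and sol: "solvable G"
  obtains qs where "length qs = fitting_length G" "distinct_adj qs" "tower G {\<one>} qs"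
proof (cases "fitting_length G")
  case 0
  then show thesis using that[of "[]"] by simp
next
  case (Suc k)
  (* The exponent 1 in the role of the forbidden prime imposes no restriction at the bottom. *)
  have "W \<subseteq> {\<one>}" if W: "W \<lhd> G" and t: "torsion_over G (powers_of 1) {\<one>} W" for W
  proof
    fix x assume x: "x \<in> W"
    have "x \<in> carrier G" using x subgroup.subset[OF normal_imp_subgroup[OF W]] by blast
    then show "x \<in> {\<one>}" using torsion_overD[OF t x] unfolding powers_of_def by auto
  qed
  then obtain qs where "length qs = Suc k" "distinct_adj (1 # qs)" "tower G {\<one>} qs"
    using tower_exists_above[OF fin sol one_is_normal, of 1 k] lower_fitting_nontrivial[OF fin, of k] Suc by auto
  then show thesis using that[of qs] Suc by (cases qs) auto
qed

lemma tower_primes: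
  "group G \<Longrightarrow> finite (carrier G) \<Longrightarrow> tower G B qs \<Longrightarrow> set qs \<subseteq> prime_factors (order G)"
proof (induction qs arbitrary: B)
  case (Cons q qs)
  interpret group G by fact
  from Cons.prems(3) obtain M N where t: "Factorial_Ring.prime q" "M \<lhd> G" "N \<lhd> G" "B \<subseteq> M" "M \<subset> N"
    "torsion_over G (powers_of q) M N" "tower G N qs"
    by (rule tower_ConsE)
  have N: "subgroup N G" using normal_imp_subgroup[OF t(3)] .
  have finN: "finite N" using Cons.prems(2) subgroup.subset[OF N] finite_subset by blast
  obtain n where n: "card N = card M * q ^ n"
    using card_power_torsion_over[OF Cons.prems(2) t(1,2) N _ t(6)] t(5) by blast
  have "card M < card N" using psubset_card_mono[OF finN t(5)] .
  then have "n \<noteq> 0" using n by (intro notI) simp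
  then have "q dvd card N" using n by simp
  also have "card N dvd order G" using lagrange[OF N] by (metis dvd_triv_right)
  finally have "q dvd order G" .
  moreover have "order G \<noteq> 0" using Cons.prems(2) order_gt_0_iff_finite by simp
  ultimately have "q \<in> prime_factors (order G)" using t(1) by (simp add: prime_factors_dvd)
  then show ?case using Cons.IH[OF Cons.prems(1,2) t(7)] by simp
qed simp

section \<open>Hall subgroups of soluble groups\<close>
lemma (in group) card_normal_set_mult:
  assumes N: "N \<lhd> G" and S: "subgroup S G"
  shows "card (N <#> S) * card (N \<inter> S) = card N * card S"
proof -
  interpret second_isomorphism_grp N G S
    by (simp add: second_isomorphism_grp_def second_isomorphism_grp_axioms_def N S)
  have NS: "subgroup (N <#> S) G" by (rule normal_set_mult_subgroup)
  interpret S: group "G\<lparr>carrier := S\<rparr>" using subgroup_imp_group[OF S] .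
  interpret NS: group "G\<lparr>carrier := N <#> S\<rparr>" using subgroup_imp_group[OF NS] .
  have NsubNS: "N \<subseteq> N <#> S"
  proof
    fix x assume x: "x \<in> N"
    then have "x \<otimes> \<one> \<in> N <#> S" unfolding set_mult_def using subgroup.one_closed[OF S] by blast
    then show "x \<in> N <#> S" using x subset by auto
  qed
  have 1: "card S = card (N \<inter> S) * order (G\<lparr>carrier := S\<rparr> Mod (N \<inter> S))"
    using S.order_eq_card_times_quotient[OF normal_Int_subgroup[OF S N]] by (simp add: order_def)
  have 2: "card (N <#> S) = card N * order (G\<lparr>carrier := N <#> S\<rparr> Mod N)"
    using NS.order_eq_card_times_quotient[OF normal_restrict_supergroup[OF NS N NsubNS]] by (simp add: order_def)
  have 3: "order (G\<lparr>carrier := S\<rparr> Mod (N \<inter> S)) = order (G\<lparr>carrier := N <#> S\<rparr> Mod N)"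
    by (rule iso_same_order[OF normal_intersection_quotient_isom])
  show ?thesis unfolding 2 3[symmetric] using 1 by (metis mult.assoc mult.commute)
qed

lemma (in group) card_subgroup_dvd:
  assumes "subgroup A G" "subgroup B G" "A \<subseteq> B" shows "card A dvd card B"
proof -
  have "card (rcosets\<^bsub>G\<lparr>carrier := B\<rparr>\<^esub> A) * card A = card B"
    using group.lagrange[OF subgroup_imp_group[OF assms(2)] subgroup_incl[OF assms]] by (simp add: order_def)
  then show ?thesis by (metis dvd_triv_right)
qed

lemma (in group) solvable_subgroup_group:
  assumes "subgroup H G" "solvable G" shows "solvable (G\<lparr>carrier := H\<rparr>)"
proof -
  have "group_hom (G\<lparr>carrier := H\<rparr>) G id"
    unfolding group_hom_def group_hom_axioms_def
    using subgroup_imp_group[OF assms(1)] is_group subgroup.subset[OF assms(1)] by (auto simp: hom_def)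
  then show ?thesis using group_hom.inj_hom_imp_solvable assms(2) by fastforce
qed

lemma (in group) relative_sylow_exists:
  assumes fin: "finite (carrier G)" and M: "M \<lhd> G" and V: "V \<lhd> G" and MV: "M \<subseteq> V"
    and s: "Factorial_Ring.prime s" and card: "card V = card M * (s ^ b * a)"
  obtains R where "subgroup R G" "M \<subseteq> R" "R \<subseteq> V" "card R = card M * s ^ b"
proof -
  interpret V: normal V G by fact
  interpret M: normal M G by fact
  let ?V = "G\<lparr>carrier := V\<rparr>"
  interpret GV: group ?V using subgroup_imp_group[OF V.is_subgroup] .
  have MV': "M \<lhd> ?V" using normal_restrict_supergroup[OF V.is_subgroup M MV] .
  interpret MV: normal M ?V by fact
  interpret q: group_hom ?V "?V Mod M" "\<lambda>x. M #>\<^bsub>?V\<^esub> x" by (rule MV.quotient_map_hom)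
  have finV: "finite V" using fin V.subset finite_subset by blast
  have cM: "card M > 0" using M.one_closed finite_subset[OF MV finV] by (metis card_gt_0_iff empty_iff)
  have "order (?V Mod M) = s ^ b * a"
    using GV.order_eq_card_times_quotient[OF MV'] card cM by (simp add: order_def)
  moreover have "finite (carrier (?V Mod M))" using finV by (simp add: carrier_FactGroup)
  ultimately obtain S where S: "subgroup S (?V Mod M)" "card S = s ^ b"
    using sylow_thm[OF s q.H.is_group] by blast
  define R where "R = {x \<in> V. M #> x \<in> S}"
  have R: "subgroup R ?V"
  proof (rule subgroup.intro)
    show "R \<subseteq> carrier ?V" unfolding R_def by auto
    show "\<one>\<^bsub>?V\<^esub> \<in> R" unfolding R_def using subgroup.one_closed[OF S(1)] V.one_closed M.subset by simp
    show "x \<otimes>\<^bsub>?V\<^esub> y \<in> R" if "x \<in> R" "y \<in> R" for x y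
      using that q.hom_mult[of x y] subgroup.m_closed[OF S(1)] unfolding R_def by simp
    show "inv\<^bsub>?V\<^esub> x \<in> R" if "x \<in> R" for x
    proof -
      have x: "x \<in> V" "M #> x \<in> S" using that unfolding R_def by auto
      have "M #> (inv\<^bsub>?V\<^esub> x) \<in> S" using q.hom_inv[of x] x subgroup.m_inv_closed[OF S(1) x(2)] by simp
      moreover have "inv\<^bsub>?V\<^esub> x \<in> V" using GV.inv_closed[of x] x by simp
      ultimately show ?thesis unfolding R_def by blast
    qed
  qed
  have RG: "subgroup R G" using incl_subgroup[OF V.is_subgroup R] .
  have MR: "M \<subseteq> R"
  proof
    fix x assume x: "x \<in> M"
    then have "M #> x = M" using M.rcos_const[OF is_group] by blast
    then show "x \<in> R" unfolding R_def using x MV subgroup.one_closed[OF S(1)] by auto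
  qed
  have RV: "R \<subseteq> V" unfolding R_def by blast
  have "rcosets\<^bsub>G\<lparr>carrier := R\<rparr>\<^esub> M = S"
  proof
    show "rcosets\<^bsub>G\<lparr>carrier := R\<rparr>\<^esub> M \<subseteq> S" unfolding RCOSETS_def R_def by auto
    show "S \<subseteq> rcosets\<^bsub>G\<lparr>carrier := R\<rparr>\<^esub> M"
    proof
      fix c assume c: "c \<in> S"
      then have "c \<in> carrier (?V Mod M)" using subgroup.subset[OF S(1)] by blast
      then obtain x where "x \<in> V" "c = M #> x" by (auto simp: carrier_FactGroup)
      then show "c \<in> rcosets\<^bsub>G\<lparr>carrier := R\<rparr>\<^esub> M" unfolding RCOSETS_def R_def using c by auto
    qed
  qed
  then have "card R = card M * s ^ b"
    using order_relative_quotient[OF M RG MR] S(2) by (simp add: order_def FactGroup_def)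
  then show thesis using that RG MR RV by blast
qed

text \<open>
  The normalizer of \<open>R\<close>, in a form that makes no reference to cosets.
\<close>
definition conj_stabilizer :: "('a, 'b) monoid_scheme \<Rightarrow> 'a set \<Rightarrow> 'a set" where
  "conj_stabilizer G R = {g \<in> carrier G. (\<lambda>x. g \<otimes>\<^bsub>G\<^esub> x \<otimes>\<^bsub>G\<^esub> inv\<^bsub>G\<^esub> g) ` R = R}"

lemma (in group) conj_stabilizer_subgroup:
  assumes R: "R \<subseteq> carrier G" shows "subgroup (conj_stabilizer G R) G"
proof (rule subgroup.intro)
  show "conj_stabilizer G R \<subseteq> carrier G" unfolding conj_stabilizer_def by blast
  have "(\<lambda>x. \<one> \<otimes> x \<otimes> inv \<one>) ` R = (\<lambda>x. x) ` R" by (rule image_cong) (use R in auto)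
  then show "\<one> \<in> conj_stabilizer G R" unfolding conj_stabilizer_def by simp
  show "x \<otimes> y \<in> conj_stabilizer G R" if xy: "x \<in> conj_stabilizer G R" "y \<in> conj_stabilizer G R" for x y
  proof -
    have c: "x \<in> carrier G" "y \<in> carrier G" "(\<lambda>u. x \<otimes> u \<otimes> inv x) ` R = R" "(\<lambda>u. y \<otimes> u \<otimes> inv y) ` R = R"
      using xy unfolding conj_stabilizer_def by auto
    have "(\<lambda>u. (x \<otimes> y) \<otimes> u \<otimes> inv (x \<otimes> y)) ` R = (\<lambda>u. x \<otimes> u \<otimes> inv x) ` ((\<lambda>u. y \<otimes> u \<otimes> inv y) ` R)"
      unfolding image_image by (rule image_cong) (use c R in \<open>auto simp: m_assoc inv_mult_group subset_iff\<close>)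
    also have "\<dots> = R" unfolding c(4) by (rule c(3))
    finally show ?thesis unfolding conj_stabilizer_def using c by simp
  qed
  show "inv x \<in> conj_stabilizer G R" if x: "x \<in> conj_stabilizer G R" for x
  proof -
    have c: "x \<in> carrier G" "(\<lambda>u. x \<otimes> u \<otimes> inv x) ` R = R" using x unfolding conj_stabilizer_def by auto
    have "(\<lambda>u. inv x \<otimes> u \<otimes> inv (inv x)) ` R = (\<lambda>u. inv x \<otimes> u \<otimes> inv (inv x)) ` ((\<lambda>u. x \<otimes> u \<otimes> inv x) ` R)"
      unfolding c(2) ..
    also have "\<dots> = (\<lambda>u. u) ` R"
      unfolding image_image by (rule image_cong) (use c R in \<open>auto simp: m_assoc inv_cancel_left subset_iff\<close>)
    finally show ?thesis unfolding conj_stabilizer_def using c by simp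
  qed
qed

lemma (in group) subgroup_subset_conj_stabilizer:
  assumes R: "subgroup R G" and finR: "finite R" shows "R \<subseteq> conj_stabilizer G R"
proof
  interpret R: subgroup R G by fact
  fix r assume r: "r \<in> R"
  have sub: "(\<lambda>x. r \<otimes> x \<otimes> inv r) ` R \<subseteq> R" using r by auto
  have "inj_on (\<lambda>x. r \<otimes> x \<otimes> inv r) R" by (rule inj_onI) (use r in auto)
  then have "(\<lambda>x. r \<otimes> x \<otimes> inv r) ` R = R" using sub finR by (metis card_image card_subset_eq)
  then show "r \<in> conj_stabilizer G R" unfolding conj_stabilizer_def using r by auto
qed

lemma (in group) normal_of_conj_stabilizer_eq_carrier:
  assumes R: "subgroup R G" and eq: "conj_stabilizer G R = carrier G" shows "R \<lhd> G"
proof (rule normal_invI[OF R])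
  fix g x assume "g \<in> carrier G" "x \<in> R"
  then show "g \<otimes> x \<otimes> inv g \<in> R" using eq unfolding conj_stabilizer_def by blast
qed

lemma (in group) normal_set_mult_is_subgroup:
  assumes "N \<lhd> G" "subgroup S G" shows "subgroup (N <#> S) G"
proof -
  interpret second_isomorphism_grp N G S
    by (simp add: second_isomorphism_grp_def second_isomorphism_grp_axioms_def assms)
  show ?thesis by (rule normal_set_mult_subgroup)
qed

text \<open>
  The Frattini argument. A conjugate \<open>R'\<close> of \<open>R\<close> acts on the cosets of \<open>R\<close> in \<open>V\<close>; their number
  is a power of \<open>p\<close>, and \<open>R' / M\<close> is an \<open>s\<close>-group, so there is a fixed coset and \<open>R'\<close> is conjugate
  to \<open>R\<close> under \<open>V\<close>. Hence \<open>V\<close> and the normalizer of \<open>R\<close> generate \<open>G\<close>, and the index of the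
  normalizer divides the index of \<open>R\<close> in \<open>V\<close>.
\<close>
lemma (in group) frattini_index:
  assumes fin: "finite (carrier G)" and M: "M \<lhd> G" and V: "V \<lhd> G"
    and R: "subgroup R G" and MR: "M \<subseteq> R" and RV: "R \<subseteq> V"
    and s: "Factorial_Ring.prime s" and p: "Factorial_Ring.prime p" and sp: "s \<noteq> p"
    and cR: "card R = card M * s ^ b" and cV: "card V = card R * p ^ a"
  shows "\<exists>c. order G = card (conj_stabilizer G R) * p ^ c"
proof -
  interpret V: normal V G by fact
  interpret M: normal M G by fact
  interpret R: subgroup R G by fact
  define N where "N = conj_stabilizer G R"
  have N: "subgroup N G" unfolding N_def by (rule conj_stabilizer_subgroup[OF R.subset])
  have finV: "finite V" using fin V.subset finite_subset by blast
  have finR: "finite R" using RV finV finite_subset by blast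
  have cRp: "card R > 0" using R.one_closed finR by (metis card_gt_0_iff empty_iff)
  have frat: "\<exists>v\<in>V. v \<otimes> g \<in> N" if g: "g \<in> carrier G" for g
  proof -
    define R' where "R' = (\<lambda>x. g \<otimes> x \<otimes> inv g) ` R"
    have R': "subgroup R' G"
    proof (rule subgroup.intro)
      show "R' \<subseteq> carrier G" unfolding R'_def using g by auto
      have "g \<otimes> \<one> \<otimes> inv g \<in> R'" unfolding R'_def using R.one_closed by (rule imageI)
      then show "\<one> \<in> R'" using g by simp
      show "x \<otimes> y \<in> R'" if xy: "x \<in> R'" "y \<in> R'" for x y
      proof -
        obtain u v where uv: "u \<in> R" "v \<in> R" "x = g \<otimes> u \<otimes> inv g" "y = g \<otimes> v \<otimes> inv g" using xy unfolding R'_def by blast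
        have "x \<otimes> y = g \<otimes> (u \<otimes> v) \<otimes> inv g" using uv g by (simp add: m_assoc inv_cancel_left)
        then show ?thesis unfolding R'_def using uv by blast
      qed
      show "inv x \<in> R'" if x: "x \<in> R'" for x
      proof -
        obtain u where u: "u \<in> R" "x = g \<otimes> u \<otimes> inv g" using x unfolding R'_def by blast
        have "inv x = g \<otimes> inv u \<otimes> inv g" using u g by (simp add: m_assoc inv_mult_group)
        then show ?thesis unfolding R'_def using u by blast
      qed
    qed
    have R'V: "R' \<subseteq> V" unfolding R'_def using RV g V.inv_op_closed2 by auto
    have MR': "M \<subseteq> R'"
    proof
      fix m assume m: "m \<in> M"
      then have "inv g \<otimes> m \<otimes> g \<in> R" using M.inv_op_closed1 g MR by blast
      then have "g \<otimes> (inv g \<otimes> m \<otimes> g) \<otimes> inv g \<in> R'" unfolding R'_def by blast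
      then show "m \<in> R'" using m g by (simp add: m_assoc inv_cancel_left)
    qed
    have "inj_on (\<lambda>x. g \<otimes> x \<otimes> inv g) R" by (rule inj_onI) (use g in auto)
    then have cR': "card R' = card R" unfolding R'_def by (rule card_image)
    define E where "E = (\<lambda>v. R #> v) ` V"
    have E: "E = rcosets\<^bsub>G\<lparr>carrier := V\<rparr>\<^esub> R" unfolding E_def RCOSETS_def by auto
    have "card E * card R = card V"
      using group.lagrange[OF subgroup_imp_group[OF V.is_subgroup] subgroup_incl[OF R V.is_subgroup RV]]
      unfolding E order_def by simp
    then have cE: "card E = p ^ a" using cV cRp by simp
    have nd: "\<not> s dvd card E"
      unfolding cE using s p sp by (metis prime_dvd_power primes_dvd_imp_eq)
    define act where "act x c = c #> inv x" for x c
    have act: "act x (R #> v) = R #> (v \<otimes> inv x)" if "x \<in> carrier G" "v \<in> carrier G" for x v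
      unfolding act_def using that coset_mult_assoc[OF R.subset] by simp
    have "\<exists>e\<in>E. \<forall>x\<in>carrier (G\<lparr>carrier := R'\<rparr>). act x e = e"
    proof (rule group.fixed_point_exists[OF subgroup_imp_group[OF R'] _ _ _ _ _ subgroup_incl[OF M.is_subgroup R' MR'] _ s _ nd])
      show "finite (carrier (G\<lparr>carrier := R'\<rparr>))" "finite E" using finite_subset[OF R'V finV] finV E_def by auto
      show "order (G\<lparr>carrier := R'\<rparr>) = card M * s ^ b" using cR cR' by (simp add: order_def)
      fix e assume e: "e \<in> E"
      then obtain v where v: "v \<in> V" "e = R #> v" unfolding E_def by blast
      have vc: "v \<in> carrier G" using v by auto
      show "act x e \<in> E" if "x \<in> carrier (G\<lparr>carrier := R'\<rparr>)" for x
      proof -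
        have x: "x \<in> V" using that R'V by auto
        then show ?thesis unfolding v(2) E_def using act[of x v] vc v(1) by auto
      qed
      show "act \<one>\<^bsub>G\<lparr>carrier := R'\<rparr>\<^esub> e = e" unfolding v(2) using act[of \<one> v] vc by simp
      show "act (x \<otimes>\<^bsub>G\<lparr>carrier := R'\<rparr>\<^esub> y) e = act x (act y e)"
        if xy: "x \<in> carrier (G\<lparr>carrier := R'\<rparr>)" "y \<in> carrier (G\<lparr>carrier := R'\<rparr>)" for x y
      proof -
        have c: "x \<in> carrier G" "y \<in> carrier G" using xy R'V V.subset by auto
        then show ?thesis unfolding v(2) using vc by (simp add: act inv_mult_group m_assoc)
      qed
      show "act m e = e" if m: "m \<in> M" for m
      proof -
        have mc: "m \<in> carrier G" using m by auto
        have "v \<otimes> inv m \<otimes> inv v \<in> R" using M.inv_op_closed2[OF vc] m MR by blast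
        then have "v \<otimes> inv m \<in> R #> v" using R.rcos_module_rev[OF is_group vc] mc vc by simp
        then have "R #> v = R #> (v \<otimes> inv m)" by (rule repr_independence[OF _ vc R])
        then show ?thesis unfolding v(2) act[OF mc vc] by simp
      qed
    qed
    then obtain v where v: "v \<in> V" "\<And>x. x \<in> R' \<Longrightarrow> act x (R #> v) = R #> v" unfolding E_def by auto
    have vc: "v \<in> carrier G" using v by auto
    have "v \<otimes> x \<otimes> inv v \<in> R" if x: "x \<in> R'" for x
    proof -
      have xc: "x \<in> carrier G" using x R'V by auto
      have xi: "inv x \<in> R'" using subgroup.m_inv_closed[OF R' x] .
      then have "R #> v = R #> (v \<otimes> x)" using v(2)[OF xi] act[of "inv x" v] vc xc by simp
      then have "v \<otimes> x \<in> R #> v" using rcos_self[OF _ R, of "v \<otimes> x"] vc xc by simp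
      then show ?thesis using R.rcos_module_imp[OF is_group vc] by blast
    qed
    then have sub: "(\<lambda>x. (v \<otimes> g) \<otimes> x \<otimes> inv (v \<otimes> g)) ` R \<subseteq> R"
    proof (intro image_subsetI)
      fix x assume x: "x \<in> R"
      assume *: "\<And>x. x \<in> R' \<Longrightarrow> v \<otimes> x \<otimes> inv v \<in> R"
      have "v \<otimes> (g \<otimes> x \<otimes> inv g) \<otimes> inv v \<in> R" using * x unfolding R'_def by blast
      then show "(v \<otimes> g) \<otimes> x \<otimes> inv (v \<otimes> g) \<in> R" using x g vc by (simp add: m_assoc inv_mult_group)
    qed
    have "inj_on (\<lambda>x. (v \<otimes> g) \<otimes> x \<otimes> inv (v \<otimes> g)) R" by (rule inj_onI) (use g vc in auto)
    then have "(\<lambda>x. (v \<otimes> g) \<otimes> x \<otimes> inv (v \<otimes> g)) ` R = R" using sub finR by (metis card_image card_subset_eq)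
    then show ?thesis using v(1) g vc unfolding N_def conj_stabilizer_def by auto
  qed
  have "carrier G \<subseteq> V <#> N"
  proof
    fix g assume g: "g \<in> carrier G"
    obtain v where v: "v \<in> V" "v \<otimes> g \<in> N" using frat[OF g] by blast
    have "g = inv v \<otimes> (v \<otimes> g)" using v g by (simp add: inv_cancel_left)
    then show "g \<in> V <#> N" unfolding set_mult_def using v V.m_inv_closed by blast
  qed
  then have VN: "V <#> N = carrier G" using setmult_subset_G[OF V.subset subgroup.subset[OF N]] by blast
  have RN: "R \<subseteq> N" unfolding N_def by (rule subgroup_subset_conj_stabilizer[OF R finR])
  have VNs: "subgroup (V \<inter> N) G" by (rule subgroups_Inter_pair[OF V.is_subgroup N])
  have "card R dvd card (V \<inter> N)" by (rule card_subgroup_dvd[OF R VNs]) (use RV RN in blast)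
  then obtain t where t: "card (V \<inter> N) = card R * t" by blast
  have "card (V \<inter> N) dvd card V" by (rule card_subgroup_dvd[OF VNs V.is_subgroup]) blast
  then obtain u where u: "card V = card (V \<inter> N) * u" by blast
  have "t * u = p ^ a" using u t cV cRp by simp
  then have "u dvd p ^ a" by (metis dvd_triv_right)
  then obtain c where c: "u = p ^ c" using divides_primepow_nat[OF p] by blast
  have "finite (V \<inter> N)" using finV by blast
  then have "card (V \<inter> N) > 0" using subgroup.one_closed[OF VNs] by (metis card_gt_0_iff empty_iff)
  moreover have "order G * card (V \<inter> N) = card (V \<inter> N) * u * card N"
    using card_normal_set_mult[OF V N] u unfolding VN order_def by simp
  ultimately have "order G = card N * p ^ c" unfolding c by simp
  then show ?thesis unfolding N_def by blast
qed

text \<open>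
  P. Hall's existence theorem for the complement of one prime, relative to a normal subgroup \<open>M\<close>,
  by induction on the order of \<open>G / M\<close>. Take an abelian \<open>r\<close>-section \<open>Y / M\<close> and the relative
  \<open>p\<close>-complement \<open>H1\<close> over \<open>Y\<close>. For \<open>r \<noteq> p\<close> it is also one over \<open>M\<close>. For \<open>r = p\<close> it is
  replaced by a \<open>p\<close>-complement of \<open>H1\<close> over \<open>M\<close>, unless \<open>H1 = G\<close>. In that case \<open>G / Y\<close> is
  a \<open>p'\<close>-group; with an \<open>s\<close>-section \<open>V / Y\<close> above \<open>Y\<close> and a Sylow \<open>s\<close>-subgroup \<open>R / M\<close> of
  \<open>V / M\<close>, the normalizer of \<open>R\<close> has \<open>p\<close>-power index. Either it is a proper subgroup, or
  \<open>R\<close> is normal and takes the place of \<open>M\<close>.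
\<close>
lemma relative_p_complement_exists:
  fixes G :: "('a, 'b) monoid_scheme"
  assumes p: "Factorial_Ring.prime p"
  shows "group G \<Longrightarrow> finite (carrier G) \<Longrightarrow> solvable G \<Longrightarrow> M \<lhd> G \<Longrightarrow>
    \<exists>H k e. subgroup H G \<and> M \<subseteq> H \<and> card H = card M * k \<and> coprime k p \<and> order G = card H * p ^ e"
proof (induction "order G - card M" arbitrary: G M rule: less_induct)
  case (less G M)
  note fin = less.prems(2) and sol = less.prems(3) and M = less.prems(4)
  interpret group G by (rule less.prems(1))
  interpret M: normal M G by (rule M)
  have finS: "finite S" if "S \<subseteq> carrier G" for S using fin that finite_subset by blast
  have cM: "card M > 0" using M.one_closed finS[OF M.subset] by (metis card_gt_0_iff empty_iff)
  show ?case
  proof (cases "M = carrier G")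
    case True
    then have "subgroup M G \<and> M \<subseteq> M \<and> card M = card M * 1 \<and> coprime 1 p \<and> order G = card M * p ^ 0"
      using M.is_subgroup by (simp add: order_def)
    then show ?thesis by blast
  next
    case False
    have MG: "card M < order G"
      unfolding order_def using psubset_card_mono[OF fin] False M.subset by blast
    obtain r Y where r: "Factorial_Ring.prime r" and Y: "Y \<lhd> G" "M \<subseteq> Y" "M \<noteq> Y"
      and tY: "torsion_over G (powers_of r) M Y"
      using abelian_torsion_section_exists[OF fin sol M normal_self M.subset False] by metis
    have Ys: "subgroup Y G" by (rule normal_imp_subgroup[OF Y(1)])
    obtain a where a: "card Y = card M * r ^ a"
      using card_power_torsion_over[OF fin r M Ys Y(2) tY] by blast
    have MY: "card M < card Y" using psubset_card_mono[OF finS[OF subgroup.subset[OF Ys]]] Y by blast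
    have "order G - card Y < order G - card M" using MY MG by linarith
    from less.hyps[OF this is_group fin sol Y(1)] obtain H1 k1 e1 where H1: "subgroup H1 G" "Y \<subseteq> H1"
      "card H1 = card Y * k1" "coprime k1 p" "order G = card H1 * p ^ e1" by blast
    (* A proper subgroup of p-power index that contains M may replace G. *)
    have inner: ?thesis if S: "subgroup S G" "M \<subseteq> S" "S \<noteq> carrier G" "order G = card S * p ^ e" for S e
    proof -
      let ?S = "G\<lparr>carrier := S\<rparr>"
      have "card S < order G" unfolding order_def using psubset_card_mono[OF fin] S subgroup.subset[OF S(1)] by blast
      then have lt: "order ?S - card M < order G - card M" using MG by (simp add: order_def)
      have "finite (carrier ?S)" using finS[OF subgroup.subset[OF S(1)]] by simp
      from less.hyps[OF lt subgroup_imp_group[OF S(1)] this solvable_subgroup_group[OF S(1) sol]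
          normal_restrict_supergroup[OF S(1) M S(2)]]
      obtain H k f where H: "subgroup H ?S" "M \<subseteq> H" "card H = card M * k" "coprime k p" "order ?S = card H * p ^ f"
        by blast
      have "order G = card H * p ^ (f + e)" using S(4) H(5) by (simp add: order_def power_add)
      then show ?thesis using incl_subgroup[OF S(1) H(1)] H by blast
    qed
    show ?thesis
    proof (cases "r = p")
      case False
      have "coprime (r ^ a * k1) p" using H1(4) False r p by (simp add: primes_coprime)
      moreover have "card H1 = card M * (r ^ a * k1)" using H1(3) a by simp
      ultimately show ?thesis using H1 Y(2) by blast
    next
      case rp: True
      show ?thesis
      proof (cases "H1 = carrier G")
        case False
        then show ?thesis using inner[OF H1(1) _ False H1(5)] H1(2) Y(2) by blast
      next
        case True
        have oG: "order G = card Y * k1" using H1(3) True by (simp add: order_def)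
        show ?thesis
        proof (cases "Y = carrier G")
          case True
          then have "order G = card M * p ^ a" using a rp by (simp add: order_def)
          moreover have "card M = card M * 1" "coprime 1 p" by simp_all
          ultimately show ?thesis using M.is_subgroup by blast
        next
          case False
          obtain s V where s: "Factorial_Ring.prime s" and V: "V \<lhd> G" "Y \<subseteq> V" "Y \<noteq> V"
            and tV: "torsion_over G (powers_of s) Y V"
            using abelian_torsion_section_exists[OF fin sol Y(1) normal_self subgroup.subset[OF Ys] False] by metis
          have Vs: "subgroup V G" by (rule normal_imp_subgroup[OF V(1)])
          obtain b where b: "card V = card Y * s ^ b"
            using card_power_torsion_over[OF fin s Y(1) Vs V(2) tV] by blast
          have YV: "card Y < card V" using psubset_card_mono[OF finS[OF subgroup.subset[OF Vs]]] V by blast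
          then have b0: "b \<noteq> 0" using b by (intro notI) simp
          have "card V dvd order G" using lagrange[OF Vs] by (metis dvd_triv_right)
          then have "s ^ b dvd k1" unfolding b oG using MY by simp
          then have "s dvd k1" using b0 by (metis dvd_power dvd_trans neq0_conv)
          then have sp: "s \<noteq> p" using H1(4) p by (metis coprime_absorb_right coprime_commute not_prime_unit)
          have cV: "card V = card M * (s ^ b * p ^ a)" using b a rp by simp
          obtain R where R: "subgroup R G" "M \<subseteq> R" "R \<subseteq> V" "card R = card M * s ^ b"
            using relative_sylow_exists[OF fin M V(1) _ s cV] Y(2) V(2) by blast
          have cVR: "card V = card R * p ^ a" using cV R(4) by simp
          obtain c where c: "order G = card (conj_stabilizer G R) * p ^ c"
            using frattini_index[OF fin M V(1) R(1-3) s p sp R(4) cVR] by blast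
          have N: "subgroup (conj_stabilizer G R) G"
            by (rule conj_stabilizer_subgroup[OF subgroup.subset[OF R(1)]])
          show ?thesis
          proof (cases "conj_stabilizer G R = carrier G")
            case False
            have "M \<subseteq> conj_stabilizer G R"
              using R(2) subgroup_subset_conj_stabilizer[OF R(1) finS[OF subgroup.subset[OF R(1)]]] by blast
            then show ?thesis using inner[OF N _ False c] by blast
          next
            case True
            have Rn: "R \<lhd> G" by (rule normal_of_conj_stabilizer_eq_carrier[OF R(1) True])
            have "s ^ b > 1" using b0 prime_gt_1_nat[OF s] one_less_power[of s b] by blast
            then have "card M < card R" unfolding R(4) using cM by simp
            then have "order G - card R < order G - card M" using MG by linarith
            from less.hyps[OF this is_group fin sol Rn] obtain H k e where H: "subgroup H G" "R \<subseteq> H"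
              "card H = card R * k" "coprime k p" "order G = card H * p ^ e" by blast
            have "card H = card M * (s ^ b * k)" using H(3) R(4) by simp
            moreover have "coprime (s ^ b * k) p" using H(4) sp s p by (simp add: primes_coprime)
            ultimately show ?thesis using H R(2) by blast
          qed
        qed
      qed
    qed
  qed
qed

lemma (in group) p_complement_exists:
  assumes "finite (carrier G)" "solvable G" "Factorial_Ring.prime p"
  obtains H e where "subgroup H G" "coprime (card H) p" "order G = card H * p ^ e"
  using relative_p_complement_exists[OF assms(3) is_group assms(1,2) one_is_normal] by auto

text \<open>
  Iterated passage to \<open>p\<close>-complements for the primes \<open>p\<close> of \<open>\<tau>\<close>.
\<close>
lemma (in group) hall_complement_exists:
  assumes fin: "finite (carrier G)" and sol: "solvable G"
  shows "finite \<tau> \<Longrightarrow> (\<And>p. p \<in> \<tau> \<Longrightarrow> Factorial_Ring.prime p) \<Longrightarrow>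
    \<exists>H m. subgroup H G \<and> order G = card H * m \<and> (\<forall>p\<in>\<tau>. \<not> p dvd card H) \<and> prime_factors m \<subseteq> \<tau>"
proof (induction \<tau> rule: finite_induct)
  case empty
  have "subgroup (carrier G) G \<and> order G = card (carrier G) * 1" using subgroup_self by (simp add: order_def)
  then show ?case by (intro exI[of _ "carrier G"] exI[of _ 1]) simp
next
  case (insert p \<tau>)
  then obtain H m where H: "subgroup H G" "order G = card H * m" "\<forall>p\<in>\<tau>. \<not> p dvd card H" "prime_factors m \<subseteq> \<tau>"
    by auto
  have p: "Factorial_Ring.prime p" using insert.prems by blast
  interpret H: group "G\<lparr>carrier := H\<rparr>" using subgroup_imp_group[OF H(1)] .
  have "finite (carrier (G\<lparr>carrier := H\<rparr>))" using fin subgroup.subset[OF H(1)] finite_subset by auto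
  then obtain K e where K: "subgroup K (G\<lparr>carrier := H\<rparr>)" "coprime (card K) p" "order (G\<lparr>carrier := H\<rparr>) = card K * p ^ e"
    using H.p_complement_exists[OF _ solvable_subgroup_group[OF H(1) sol] p] by blast
  have cH: "card H = card K * p ^ e" using K(3) by (simp add: order_def)
  have "\<not> p dvd card K" using K(2) p by (metis coprime_absorb_right coprime_commute not_prime_unit)
  moreover have "\<not> q dvd card K" if "q \<in> \<tau>" for q using H(3) that cH by auto
  moreover have "order G = card K * (p ^ e * m)" using H(2) cH by simp
  moreover have "prime_factors (p ^ e * m) \<subseteq> insert p \<tau>"
  proof
    fix q assume "q \<in> prime_factors (p ^ e * m)"
    then have q: "Factorial_Ring.prime q" "q dvd p ^ e * m" "p ^ e * m \<noteq> 0" by (auto simp: in_prime_factors_iff)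
    then have "q dvd p ^ e \<or> q dvd m" using prime_dvd_mult_iff by blast
    then show "q \<in> insert p \<tau>"
    proof
      assume "q dvd p ^ e"
      then show ?thesis using q(1) p by (metis insertI1 prime_dvd_power primes_dvd_imp_eq)
    next
      assume "q dvd m"
      then have "q \<in> prime_factors m" using q by (simp add: in_prime_factors_iff)
      then show ?thesis using H(4) by blast
    qed
  qed
  ultimately show ?case using incl_subgroup[OF H(1) K(1)] by blast
qed

section \<open>Towers in a p-complement\<close>

text \<open>
  The index of \<open>M <#> H\<close> in \<open>N <#> H\<close> divides the index of \<open>H\<close> in \<open>G\<close>, a power of \<open>p\<close>, and
  the order of \<open>N / M\<close>, a power of \<open>q\<close>; so it is \<open>1\<close>.
\<close>
lemma (in group) p_complement_covers:
  assumes fin: "finite (carrier G)" and H: "subgroup H G" and oG: "order G = card H * p ^ e"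
    and p: "Factorial_Ring.prime p" and q: "Factorial_Ring.prime q" and pq: "q \<noteq> p"
    and M: "M \<lhd> G" and N: "N \<lhd> G" and MN: "M \<subseteq> N" and tor: "torsion_over G (powers_of q) M N"
    and x: "x \<in> N"
  obtains m h where "m \<in> M" "h \<in> N \<inter> H" "x = m \<otimes> h"
proof -
  interpret M: normal M G by fact
  interpret N: normal N G by fact
  interpret H: subgroup H G by fact
  have MH: "subgroup (M <#> H) G" "subgroup (N <#> H) G"
    using normal_set_mult_is_subgroup M N H by auto
  have le: "M <#> H \<subseteq> N <#> H" by (rule mono_set_mult[OF MN subset_refl])
  have HM: "H \<subseteq> M <#> H"
  proof
    fix h assume h: "h \<in> H"
    then have "\<one> \<otimes> h \<in> M <#> H" unfolding set_mult_def using M.one_closed by blast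
    then show "h \<in> M <#> H" using h by simp
  qed
  have pos: "card S > 0" if "subgroup S G" for S
    using that fin subgroup.one_closed subgroup.subset by (metis card_gt_0_iff empty_iff finite_subset)
  have NHs: "subgroup (N \<inter> H) G" "subgroup (M \<inter> H) G"
    using subgroups_Inter_pair N.is_subgroup M.is_subgroup H by auto
  obtain t where t: "card (N <#> H) = card (M <#> H) * t" using card_subgroup_dvd[OF MH(1,2) le] by blast
  obtain u where u: "card (M <#> H) = card H * u" using card_subgroup_dvd[OF H MH(1) HM] by blast
  obtain v where v: "order G = card (N <#> H) * v"
    using card_subgroup_dvd[OF MH(2) subgroup_self subgroup.subset[OF MH(2)]] unfolding order_def by blast
  have "card H * (u * t * v) = card H * p ^ e" using t u v oG by (metis mult.assoc)
  then have "u * t * v = p ^ e" using pos[OF H] by simp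
  then have "t dvd p ^ e" by (metis dvd_triv_left dvd_mult_left dvd_mult_right)
  obtain n where n: "card N = card M * q ^ n"
    using card_power_torsion_over[OF fin q M N.is_subgroup MN tor] by blast
  obtain w where w: "card (N \<inter> H) = card (M \<inter> H) * w" using card_subgroup_dvd[OF NHs(2,1)] MN by blast
  have 1: "card (N <#> H) * card (N \<inter> H) = card N * card H" by (rule card_normal_set_mult[OF N H])
  have 2: "card (M <#> H) * card (M \<inter> H) = card M * card H" by (rule card_normal_set_mult[OF M H])
  have "(card (M <#> H) * card (M \<inter> H)) * (t * w) = card (N <#> H) * card (N \<inter> H)" unfolding t w by simp
  also have "\<dots> = (card M * card H) * q ^ n" unfolding 1 n by simp
  finally have "(card M * card H) * (t * w) = (card M * card H) * q ^ n" unfolding 2 .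
  moreover have "card M * card H > 0" using pos[OF H] pos[OF M.is_subgroup] by simp
  ultimately have "t * w = q ^ n" by simp
  then have "t dvd q ^ n" by (metis dvd_triv_left)
  moreover have "coprime (p ^ e) (q ^ n)" using p q pq by (simp add: primes_coprime)
  ultimately have "t = 1" using \<open>t dvd p ^ e\<close> by (metis coprime_common_divisor_nat)
  then have "card (M <#> H) = card (N <#> H)" using t by simp
  then have eq: "M <#> H = N <#> H"
    using card_subset_eq[OF _ le] finite_subset[OF subgroup.subset[OF MH(2)] fin] by blast
  have "x \<otimes> \<one> \<in> N <#> H" unfolding set_mult_def using x H.one_closed by blast
  then have "x \<in> M <#> H" using x eq by simp
  then obtain m h where mh: "m \<in> M" "h \<in> H" "x = m \<otimes> h" unfolding set_mult_def by blast
  have c: "m \<in> carrier G" "h \<in> carrier G" using mh by auto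
  have "h = inv m \<otimes> x" using mh c by (simp add: inv_cancel_left)
  then have "h \<in> N" using x mh(1) MN by auto
  then show thesis using that mh by blast
qed

text \<open>
  Since \<open>N = M <#> (N \<inter> H)\<close>, an element that centralizes \<open>N \<inter> H\<close> modulo \<open>M \<inter> H\<close> centralizes
  \<open>N / M\<close>.
\<close>
lemma (in group) tower_p_complement:
  assumes fin: "finite (carrier G)" and H: "subgroup H G" and oG: "order G = card H * p ^ e"
    and p: "Factorial_Ring.prime p"
  shows "tower G B qs \<Longrightarrow> tower (G\<lparr>carrier := H\<rparr>) (B \<inter> H) (filter (\<lambda>q. q \<noteq> p) qs)"
proof (induction qs arbitrary: B)
  case (Cons q qs)
  from Cons.prems obtain M N where t: "Factorial_Ring.prime q" "M \<lhd> G" "N \<lhd> G" "B \<subseteq> M" "M \<subset> N"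
    "torsion_over G (powers_of q) M N" "centralizer_mod G N M \<subseteq> N" "tower G N qs"
    by (rule tower_ConsE)
  interpret H: subgroup H G by fact
  interpret M: normal M G by (rule t(2))
  interpret N: normal N G by (rule t(3))
  note IH = Cons.IH[OF t(8)]
  show ?case
  proof (cases "q = p")
    case True
    have "tower (G\<lparr>carrier := H\<rparr>) (B \<inter> H) (filter (\<lambda>q. q \<noteq> p) qs)"
      by (rule tower_antimono[OF IH]) (use t in blast)
    then show ?thesis using True by simp
  next
    case False
    have MN: "M \<subseteq> N" using t by blast
    note cov = p_complement_covers[OF fin H oG p t(1) False t(2,3) MN t(6)]
    have "tower (G\<lparr>carrier := H\<rparr>) (B \<inter> H) (q # filter (\<lambda>q. q \<noteq> p) qs)"
    proof (rule tower_ConsI[OF t(1) normal_Int_subgroup[OF H t(2)] normal_Int_subgroup[OF H t(3)] _ _ _ _ IH])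
      show "B \<inter> H \<subseteq> M \<inter> H" using t by blast
      show "M \<inter> H \<subset> N \<inter> H"
      proof -
        have "M \<inter> H \<noteq> N \<inter> H"
        proof
          assume eq: "M \<inter> H = N \<inter> H"
          have "N \<subseteq> M"
          proof
            fix x assume "x \<in> N"
            then obtain m h where "m \<in> M" "h \<in> N \<inter> H" "x = m \<otimes> h" by (rule cov)
            then show "x \<in> M" using eq by blast
          qed
          then show False using t(5) by blast
        qed
        then show ?thesis using MN by blast
      qed
      show "torsion_over (G\<lparr>carrier := H\<rparr>) (powers_of q) (M \<inter> H) (N \<inter> H)"
        unfolding torsion_over_def
      proof
        fix x assume x: "x \<in> N \<inter> H"
        then obtain k where k: "k \<in> powers_of q" "x [^] k \<in> M" using torsion_overD[OF t(6)] by blast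
        have "x [^] k \<in> H" using subgroup_nat_pow_closed[OF H] x by blast
        then have "x [^]\<^bsub>G\<lparr>carrier := H\<rparr>\<^esub> k \<in> M \<inter> H" using k by (simp add: nat_pow_consistent[symmetric])
        then show "\<exists>k\<in>powers_of q. x [^]\<^bsub>G\<lparr>carrier := H\<rparr>\<^esub> k \<in> M \<inter> H" using k(1) by blast
      qed
      show "centralizer_mod (G\<lparr>carrier := H\<rparr>) (N \<inter> H) (M \<inter> H) \<subseteq> N \<inter> H"
      proof
        fix c assume "c \<in> centralizer_mod (G\<lparr>carrier := H\<rparr>) (N \<inter> H) (M \<inter> H)"
        then have cH: "c \<in> H" and comm: "\<And>h. h \<in> N \<inter> H \<Longrightarrow> h \<otimes> c \<otimes> inv h \<otimes> inv c \<in> M"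
          using H by (auto simp: centralizer_mod_def)
        have cc: "c \<in> carrier G" using cH by auto
        have "x \<otimes> c \<otimes> inv x \<otimes> inv c \<in> M" if "x \<in> N" for x
        proof -
          from that obtain m h where mh: "m \<in> M" "h \<in> N \<inter> H" "x = m \<otimes> h" by (rule cov)
          have c: "m \<in> carrier G" "h \<in> carrier G" using mh by auto
          have "x \<otimes> c \<otimes> inv x \<otimes> inv c = m \<otimes> (h \<otimes> c \<otimes> inv h \<otimes> inv c) \<otimes> (c \<otimes> inv m \<otimes> inv c)"
            unfolding mh(3) using c cc by (simp add: m_assoc inv_mult_group inv_cancel_left)
          moreover have "c \<otimes> inv m \<otimes> inv c \<in> M" using mh(1) cc M.inv_op_closed2 by simp
          ultimately show ?thesis using comm[OF mh(2)] mh(1) by simp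
        qed
        then have "c \<in> centralizer_mod G N M" unfolding centralizer_mod_def using cc by blast
        then show "c \<in> N \<inter> H" using t(7) cH by blast
      qed
    qed
    then show ?thesis using False by simp
  qed
qed simp

section \<open>Deleting a letter from a word\<close>
lemma length_remdups_adj_Cons_ge:
  assumes "xs = [] \<or> hd xs \<noteq> x"
  shows "length (remdups_adj (x # xs)) = Suc (length (remdups_adj xs))"
  using assms by (cases xs) auto

lemma length_remdups_adj_le_Cons: "length (remdups_adj xs) \<le> length (remdups_adj (x # xs))"
  by (cases xs) auto

text \<open>
  Putting a letter \<open>x\<close> in front of a word that begins with \<open>y \<noteq> x\<close> lengthens the reduced word
  by one for every deleted letter other than \<open>x\<close> and \<open>y\<close>. So the sum grows by at least
  \<open>card \<sigma> - 2\<close>, starting with the value \<open>2 * card \<sigma> - 2\<close> at words of length two.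
\<close>
lemma sum_length_remdups_adj_filter:
  fixes \<sigma> :: "'c set"
  assumes fin: "finite \<sigma>"
  shows "distinct_adj qs \<Longrightarrow> set qs \<subseteq> \<sigma> \<Longrightarrow> length qs \<ge> 2 \<Longrightarrow>
    card \<sigma> * length qs + 2 \<le> (\<Sum>p\<in>\<sigma>. length (remdups_adj (filter (\<lambda>q. q \<noteq> p) qs))) + 2 * length qs"
proof (induction qs)
  case (Cons x qs)
  define f where "f p qs = length (remdups_adj (filter (\<lambda>q. q \<noteq> p) qs))" for p and qs :: "'c list"
  obtain y zs where qs: "qs = y # zs" using Cons.prems(3) by (cases qs) auto
  have xy: "x \<noteq> y" "x \<in> \<sigma>" "y \<in> \<sigma>" using Cons.prems qs by auto
  have c2: "card {x, y} = 2" using xy by simp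
  have ge2: "card \<sigma> \<ge> 2" using card_mono[OF fin, of "{x, y}"] xy c2 by simp
  have split: "(\<Sum>p\<in>\<sigma>. g p) = (\<Sum>p\<in>\<sigma> - {x, y}. g p) + (g x + g y)" for g :: "'c \<Rightarrow> nat"
  proof -
    have "(\<Sum>p\<in>\<sigma>. g p) = (\<Sum>p\<in>\<sigma> - {x, y}. g p) + (\<Sum>p\<in>{x, y}. g p)"
      by (rule sum.subset_diff[OF _ fin]) (use xy in blast)
    then show ?thesis using xy(1) by simp
  qed
  have step: "f p (x # qs) = Suc (f p qs)" if "p \<in> \<sigma> - {x, y}" for p
    using that xy(1) unfolding f_def qs by (auto simp: length_remdups_adj_Cons_ge)
  have ex: "f x qs \<le> f x (x # qs)" and ey: "f y qs \<le> f y (x # qs)"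
    using length_remdups_adj_le_Cons unfolding f_def by auto
  have cd: "card (\<sigma> - {x, y}) = card \<sigma> - 2" using c2 xy by (simp add: card_Diff_subset)
  have "(\<Sum>p\<in>\<sigma> - {x, y}. f p (x # qs)) = (\<Sum>p\<in>\<sigma> - {x, y}. Suc (f p qs))" by (rule sum.cong) (use step in auto)
  also have "\<dots> = (\<Sum>p\<in>\<sigma> - {x, y}. f p qs) + (card \<sigma> - 2)" unfolding sum_Suc cd ..
  finally have inc: "(\<Sum>p\<in>\<sigma>. f p qs) + (card \<sigma> - 2) \<le> (\<Sum>p\<in>\<sigma>. f p (x # qs))"
    using split[of "\<lambda>p. f p qs"] split[of "\<lambda>p. f p (x # qs)"] ex ey by linarith
  have "card \<sigma> * length (x # qs) + 2 \<le> (\<Sum>p\<in>\<sigma>. f p (x # qs)) + 2 * length (x # qs)"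
  proof (cases "zs = []")
    case True
    have "f p [y] = 1" if "p \<noteq> y" for p using that unfolding f_def by simp
    then have "(\<Sum>p\<in>\<sigma> - {x, y}. f p qs) = card \<sigma> - 2" "f x qs = 1" unfolding qs True using cd xy by auto
    moreover have "f y (x # qs) = 1" unfolding f_def qs True using xy by simp
    moreover have "(\<Sum>p\<in>\<sigma> - {x, y}. f p (x # qs)) = (\<Sum>p\<in>\<sigma> - {x, y}. f p qs) + (card \<sigma> - 2)"
      using \<open>(\<Sum>p\<in>\<sigma> - {x, y}. f p (x # qs)) = (\<Sum>p\<in>\<sigma> - {x, y}. Suc (f p qs))\<close>
        \<open>(\<Sum>p\<in>\<sigma> - {x, y}. Suc (f p qs)) = (\<Sum>p\<in>\<sigma> - {x, y}. f p qs) + (card \<sigma> - 2)\<close> by simp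
    ultimately show ?thesis using split[of "\<lambda>p. f p (x # qs)"] ex ge2 unfolding qs True by simp
  next
    case False
    then have "length qs \<ge> 2" unfolding qs by (cases zs) auto
    moreover have "distinct_adj qs" "set qs \<subseteq> \<sigma>" using Cons.prems qs by auto
    ultimately have "card \<sigma> * length qs + 2 \<le> (\<Sum>p\<in>\<sigma>. f p qs) + 2 * length qs"
      using Cons.IH unfolding f_def by blast
    then show ?thesis using inc ge2 by simp
  qed
  then show ?case unfolding f_def .
qed simp

section \<open>The inequality between maximal Fitting lengths\<close>
lemma (in group) hall_subgroup_exists:
  assumes fin: "finite (carrier G)" and sol: "solvable G" and \<sigma>: "\<sigma> \<subseteq> prime_divisors G"
  obtains H where "hall_subgroup \<sigma> H G"
proof -
  define \<tau> where "\<tau> = prime_divisors G - \<sigma>"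
  have "finite \<tau>" "\<And>p. p \<in> \<tau> \<Longrightarrow> Factorial_Ring.prime p" unfolding \<tau>_def prime_divisors_def by auto
  from hall_complement_exists[OF fin sol this] obtain H m where H: "subgroup H G" "order G = card H * m"
    "\<forall>p\<in>\<tau>. \<not> p dvd card H" "prime_factors m \<subseteq> \<tau>" by blast
  have pos: "order G > 0" using fin order_gt_0_iff_finite by simp
  then have pH: "card H > 0" and m0: "m > 0" using H(2) by auto
  have "card (rcosets H) * card H = card H * m" using lagrange[OF H(1)] H(2) by simp
  then have idx: "card (rcosets H) = m" using pH by simp
  have "prime_factors (card H) \<subseteq> \<sigma>"
  proof
    fix q assume "q \<in> prime_factors (card H)"
    then have q: "Factorial_Ring.prime q" "q dvd card H" by (auto simp: in_prime_factors_iff)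
    then have "q \<in> prime_divisors G" unfolding prime_divisors_def using H(2) pos by (simp add: in_prime_factors_iff)
    then show "q \<in> \<sigma>" using H(3) q(2) unfolding \<tau>_def by blast
  qed
  moreover have "\<not> p dvd card (rcosets H)" if "p \<in> \<sigma>" for p
  proof
    assume "p dvd card (rcosets H)"
    moreover have "Factorial_Ring.prime p" using that \<sigma> unfolding prime_divisors_def by auto
    ultimately have "p \<in> prime_factors m" unfolding idx using m0 by (simp add: in_prime_factors_iff)
    then show False using H(4) that unfolding \<tau>_def by blast
  qed
  ultimately show thesis using that H(1) unfolding hall_subgroup_def by blast
qed

lemma (in group) hall_fitting_lengths_finite:
  assumes "finite (carrier G)"
  shows "finite {fitting_length (G\<lparr>carrier := H\<rparr>) | \<sigma> H.
            \<sigma> \<subseteq> prime_divisors G \<and> card \<sigma> = l \<and> hall_subgroup \<sigma> H G}"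
proof (rule finite_subset)
  show "{fitting_length (G\<lparr>carrier := H\<rparr>) | \<sigma> H.
            \<sigma> \<subseteq> prime_divisors G \<and> card \<sigma> = l \<and> hall_subgroup \<sigma> H G}
    \<subseteq> (\<lambda>H. fitting_length (G\<lparr>carrier := H\<rparr>)) ` Pow (carrier G)"
    using subgroup.subset unfolding hall_subgroup_def by blast
  show "finite ((\<lambda>H. fitting_length (G\<lparr>carrier := H\<rparr>)) ` Pow (carrier G))" using assms by simp
qed

lemma (in group) fitting_length_le_hall_fitting_length:
  assumes "finite (carrier G)" "\<sigma> \<subseteq> prime_divisors G" "card \<sigma> = l" "hall_subgroup \<sigma> H G"
  shows "fitting_length (G\<lparr>carrier := H\<rparr>) \<le> hall_fitting_length l G"
  unfolding hall_fitting_length_def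
  by (rule Max_ge[OF hall_fitting_lengths_finite[OF assms(1)]]) (use assms in blast)

text \<open>
  Existence of Hall subgroups is what makes the maximum a value of the Fitting length.
\<close>
lemma (in group) hall_fitting_length_attained:
  assumes fin: "finite (carrier G)" and sol: "solvable G" and l: "l \<le> num_prime_divisors G"
  obtains \<sigma> H where "\<sigma> \<subseteq> prime_divisors G" "card \<sigma> = l" "hall_subgroup \<sigma> H G"
    "hall_fitting_length l G = fitting_length (G\<lparr>carrier := H\<rparr>)"
proof -
  let ?S = "{fitting_length (G\<lparr>carrier := H\<rparr>) | \<sigma> H.
            \<sigma> \<subseteq> prime_divisors G \<and> card \<sigma> = l \<and> hall_subgroup \<sigma> H G}"
  obtain \<sigma> where \<sigma>: "\<sigma> \<subseteq> prime_divisors G" "card \<sigma> = l"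
    using l obtain_subset_with_card_n[of l "prime_divisors G"] unfolding num_prime_divisors_def by metis
  obtain H where "hall_subgroup \<sigma> H G" using hall_subgroup_exists[OF fin sol \<sigma>(1)] .
  then have "?S \<noteq> {}" using \<sigma> by blast
  from Max_in[OF hall_fitting_lengths_finite[OF fin] this] show thesis
    using that unfolding hall_fitting_length_def by blast
qed

lemma (in group) hall_subgroup_p_complement:
  assumes fin: "finite (carrier G)" and H: "hall_subgroup \<sigma> H G"
    and p: "p \<in> \<sigma>" "Factorial_Ring.prime p"
    and K: "subgroup K (G\<lparr>carrier := H\<rparr>)" and c: "card H = card K * p ^ e" and cop: "coprime (card K) p"
    and \<sigma>: "\<And>q. q \<in> \<sigma> \<Longrightarrow> Factorial_Ring.prime q"
  shows "hall_subgroup (\<sigma> - {p}) K G"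
proof -
  have Hs: "subgroup H G" and pH: "prime_factors (card H) \<subseteq> \<sigma>" and iH: "\<forall>q\<in>\<sigma>. \<not> q dvd card (rcosets H)"
    using H unfolding hall_subgroup_def by auto
  have Ks: "subgroup K G" by (rule incl_subgroup[OF Hs K])
  have pos: "order G > 0" using fin order_gt_0_iff_finite by simp
  have oH: "card (rcosets H) * card H = order G" by (rule lagrange[OF Hs])
  have oK: "card (rcosets K) * card K = order G" by (rule lagrange[OF Ks])
  have cK: "card K > 0" and cH: "card H > 0" using oK oH pos by (auto intro: Nat.gr0I)
  have "card (rcosets K) * card K = (card (rcosets H) * p ^ e) * card K"
    using oH oK c by (simp add: mult.commute mult.left_commute)
  then have idx: "card (rcosets K) = card (rcosets H) * p ^ e" using cK by simp
  have "prime_factors (card K) \<subseteq> \<sigma> - {p}"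
  proof
    fix q assume "q \<in> prime_factors (card K)"
    then have q: "Factorial_Ring.prime q" "q dvd card K" by (auto simp: in_prime_factors_iff)
    then have "q \<in> prime_factors (card H)" using c cH by (simp add: in_prime_factors_iff)
    moreover have "q \<noteq> p" using q cop by (metis coprime_absorb_right coprime_commute not_prime_unit)
    ultimately show "q \<in> \<sigma> - {p}" using pH by blast
  qed
  moreover have "\<not> q dvd card (rcosets K)" if q: "q \<in> \<sigma> - {p}" for q
  proof
    assume "q dvd card (rcosets K)"
    then have "q dvd card (rcosets H) \<or> q dvd p ^ e" unfolding idx using \<sigma>[of q] q prime_dvd_mult_iff by blast
    moreover have "\<not> q dvd p ^ e" using \<sigma>[of q] q p(2) by (metis DiffD1 DiffD2 insertI1 prime_dvd_power primes_dvd_imp_eq)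
    ultimately show False using iH q by blast
  qed
  ultimately show ?thesis unfolding hall_subgroup_def using Ks by blast
qed

theorem theoremC:
  fixes G :: "('a, 'b) monoid_scheme" and l :: nat
  assumes "group G" and "finite (carrier G)" and "solvable G"
    and "num_prime_divisors G \<ge> 3"
    and "3 \<le> l" and "l \<le> num_prime_divisors G"
  shows "real (hall_fitting_length l G)
           \<le> (real l * real (hall_fitting_length (l - 1) G) - 2) / (real l - 2)"
proof -
  interpret group G by fact
  note fin = assms(2) and sol = assms(3)
  define m where "m = hall_fitting_length (l - 1) G"
  obtain \<sigma> H where \<sigma>: "\<sigma> \<subseteq> prime_divisors G" "card \<sigma> = l" and H: "hall_subgroup \<sigma> H G"
    and h: "hall_fitting_length l G = fitting_length (G\<lparr>carrier := H\<rparr>)"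
    using hall_fitting_length_attained[OF fin sol assms(6)] .
  let ?H = "G\<lparr>carrier := H\<rparr>"
  have Hs: "subgroup H G" using H unfolding hall_subgroup_def by blast
  interpret H: group ?H using subgroup_imp_group[OF Hs] .
  have finH: "finite (carrier ?H)" using fin subgroup.subset[OF Hs] finite_subset by auto
  have solH: "solvable ?H" by (rule solvable_subgroup_group[OF Hs sol])
  have \<sigma>p: "Factorial_Ring.prime q" if "q \<in> \<sigma>" for q using that \<sigma>(1) unfolding prime_divisors_def by auto
  have fin\<sigma>: "finite \<sigma>" using \<sigma>(2) assms(5) by (intro card_ge_0_finite) simp
  have "\<exists>K e. subgroup K ?H \<and> card H = card K * p ^ e \<and> fitting_length (G\<lparr>carrier := K\<rparr>) \<le> m"
    if p: "p \<in> \<sigma>" for p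
  proof -
    obtain K e where K: "subgroup K ?H" "coprime (card K) p" "order ?H = card K * p ^ e"
      using H.p_complement_exists[OF finH solH \<sigma>p[OF p]] .
    have c: "card H = card K * p ^ e" using K(3) by (simp add: order_def)
    have "hall_subgroup (\<sigma> - {p}) K G"
      by (rule hall_subgroup_p_complement[OF fin H p \<sigma>p[OF p] K(1) c K(2) \<sigma>p])
    moreover have "card (\<sigma> - {p}) = l - 1" using \<sigma>(2) p by simp
    ultimately have "fitting_length (G\<lparr>carrier := K\<rparr>) \<le> m"
      unfolding m_def using fitting_length_le_hall_fitting_length[OF fin, of "\<sigma> - {p}"] \<sigma>(1) by blast
    then show ?thesis using K(1) c by blast
  qed
  then obtain K e where K: "\<And>p. p \<in> \<sigma> \<Longrightarrow> subgroup (K p) ?H" "\<And>p. p \<in> \<sigma> \<Longrightarrow> card H = card (K p) * p ^ e p"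
    "\<And>p. p \<in> \<sigma> \<Longrightarrow> fitting_length (G\<lparr>carrier := K p\<rparr>) \<le> m" by metis
  obtain qs where qs: "length qs = fitting_length ?H" "distinct_adj qs" "tower ?H {\<one>\<^bsub>?H\<^esub>} qs"
    using H.tower_exists[OF finH solH] .
  have qs\<sigma>: "set qs \<subseteq> \<sigma>"
    using tower_primes[OF H.is_group finH qs(3)] H unfolding hall_subgroup_def order_def by auto
  have le: "length (remdups_adj (filter (\<lambda>q. q \<noteq> p) qs)) \<le> m" if p: "p \<in> \<sigma>" for p
  proof -
    let ?K = "G\<lparr>carrier := K p\<rparr>"
    have Ks: "subgroup (K p) G" by (rule incl_subgroup[OF Hs K(1)[OF p]])
    have finK: "finite (carrier ?K)" using fin subgroup.subset[OF Ks] finite_subset by auto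
    have "tower (?H\<lparr>carrier := K p\<rparr>) ({\<one>\<^bsub>?H\<^esub>} \<inter> K p) (filter (\<lambda>q. q \<noteq> p) qs)"
    proof (rule H.tower_p_complement[OF finH K(1)[OF p] _ \<sigma>p[OF p] qs(3)])
      show "order ?H = card (K p) * p ^ e p" using K(2)[OF p] by (simp add: order_def)
    qed
    then have "tower ?K ({\<one>\<^bsub>G\<^esub>} \<inter> K p) (remdups_adj (filter (\<lambda>q. q \<noteq> p) qs))"
      using tower_remdups_adj by auto
    then have "length (remdups_adj (filter (\<lambda>q. q \<noteq> p) qs)) \<le> fitting_length ?K"
      using group.tower_length_le_fitting_length[OF subgroup_imp_group[OF Ks] finK solvable_subgroup_group[OF Ks sol]]
        subgroup.one_closed[OF Ks] by (simp add: distinct_adj_remdups_adj)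
    then show ?thesis using K(3)[OF p] by simp
  qed
  (* A trivial p-complement would leave p as the only prime divisor of the order of H. *)
  have m1: "m \<ge> 1"
  proof (rule ccontr)
    assume "\<not> m \<ge> 1"
    then have m0: "m = 0" by simp
    obtain p where p: "p \<in> \<sigma>" using \<sigma>(2) assms(5) by fastforce
    let ?K = "G\<lparr>carrier := K p\<rparr>"
    have Ks: "subgroup (K p) G" by (rule incl_subgroup[OF Hs K(1)[OF p]])
    have finK: "finite (carrier ?K)" using fin subgroup.subset[OF Ks] finite_subset by auto
    have "fitting_length ?K = 0" using K(3)[OF p] m0 by simp
    then have "K p = {\<one>\<^bsub>G\<^esub>}"
      using group.fitting_series_reaches_carrier[OF subgroup_imp_group[OF Ks] finK solvable_subgroup_group[OF Ks sol]]
      by simp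
    then have cH: "card H = p ^ e p" using K(2)[OF p] by simp
    have "\<sigma> \<subseteq> {p}"
    proof
      fix q assume q: "q \<in> \<sigma>"
      then have "q dvd order G" using \<sigma>(1) unfolding prime_divisors_def by auto
      then have "q dvd card (rcosets\<^bsub>G\<^esub> H) * card H" using lagrange[OF Hs] by simp
      moreover have "\<not> q dvd card (rcosets\<^bsub>G\<^esub> H)" using H q unfolding hall_subgroup_def by blast
      ultimately have "q dvd p ^ e p" using cH \<sigma>p[OF q] prime_dvd_mult_iff by metis
      then show "q \<in> {p}" using \<sigma>p[OF q] \<sigma>p[OF p] by (metis insertI1 prime_dvd_power primes_dvd_imp_eq)
    qed
    then have "card \<sigma> \<le> 1" using card_mono[of "{p}" \<sigma>] by simp
    then show False using \<sigma>(2) assms(5) by simp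
  qed
  have main: "l * fitting_length ?H + 2 \<le> l * m + 2 * fitting_length ?H"
  proof (cases "length qs \<ge> 2")
    case True
    have "(\<Sum>p\<in>\<sigma>. length (remdups_adj (filter (\<lambda>q. q \<noteq> p) qs))) \<le> (\<Sum>p\<in>\<sigma>. m)"
      by (rule sum_mono) (rule le)
    then show ?thesis using sum_length_remdups_adj_filter[OF fin\<sigma> qs(2) qs\<sigma> True] \<sigma>(2) qs(1) by simp
  next
    case False
    then have "fitting_length ?H = 0 \<or> fitting_length ?H = 1" using qs(1) by linarith
    moreover have "l \<le> l * m" using m1 by simp
    moreover from this have "2 \<le> l * m" using assms(5) by linarith
    ultimately show ?thesis by (elim disjE) simp_all
  qed
  have "real l * real (fitting_length ?H) + 2 \<le> real l * real m + 2 * real (fitting_length ?H)"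
    using main by (metis (mono_tags) of_nat_add of_nat_le_iff of_nat_mult of_nat_numeral)
  then have "real (fitting_length ?H) * (real l - 2) \<le> real l * real m - 2" by (simp add: algebra_simps)
  then show ?thesis unfolding h m_def[symmetric] using assms(5) by (simp add: pos_le_divide_eq)
qed

end
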